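(* Let $\theta\in\mathbb H_d(\mathbb C)$ be arbitrary, let $0<\alpha<1$, and let $\mathbb P_\theta$ be the distribution of $(Y,X)$ in the model $Y_i=\mathrm{tr}(X^i\theta)+\varepsilon_i$, $i=1,\dots,n$, where $\varepsilon_1,\dots,\varepsilon_n$ are i.i.d. $N(0,\sigma^2)$, independent of the design matrices $X^1,\dots,X^n$. Let $\tilde\theta$ be a fixed Hermitian $d\times d$ matrix (an estimator computed from an independent sample, on which one conditions), and for $z\ge0$ let $C_n=C_n(z)$ be the confidence set defined in the context. a) Assume the design is isotropic sub-Gaussian: $\theta$ (and $\tilde\theta$) have real entries, the entries $X^i_{m,k}$, $1\le m,k\le d$, $1\le i\le n$, are i.i.d. real random variables with mean zero and unit variance, and there are fixed constants $\tau_1,\tau_2>0$ such that for every $M\in\mathbb M_d(\mathbb R)$ with $\|M\|_F\le1$ the variable $\mathrm{tr}(X^iM)$ satisfies $\mathbb E e^{\lambda\,\mathrm{tr}(X^iM)}\le\tau_1e^{\lambda^2\tau_2^2}$ for all $\lambda\in\mathbb R$. Let $C_n$ be the confidence set with $z=0$. Then for every $n\in\mathbb N$, $$\mathbb P_\theta(\theta\in C_n)\ge 1-\frac{2\alpha}{3}-2e^{-cn},$$ where $c>0$ is a numerical constant (depending only on the design constants $\tau_1,\tau_2$). If the $X^i_{m,k}$ are standard Gaussian, $c=1/24$ is admissible. b) Assume that $X^1,\dots,X^n$ are drawn independently and uniformly at random from $\{dE_1,\dots,dE_{d^2}\}$, where $\{E_1,\dots,E_{d^2}\}\subset\mathbb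 H_d(\mathbb C)$ is a basis of $\mathbb M_d(\mathbb C)$, orthonormal for the Frobenius inner product, with $\|E_i\|_{op}\le K/\sqrt d$ for all $i$ and some $K>0$. Assume $\theta\in\Theta_+$ and $\tilde\theta\in\Theta_+$, and let $C_n$ be the confidence set with some $z>0$. Then for every $n\in\mathbb N$, $$\mathbb P_\theta(\theta\in C_n)\ge1-\frac{2\alpha}{3}-2e^{-C(K)z},\qquad C(K)=\frac{1}{(16+8/3)K^2}.$$
   Context: $\mathbb M_d(\mathbb K)$ is the space of $d\times d$ matrices over $\mathbb K\in\{\mathbb R,\mathbb C\}$ and $\mathbb H_d(\mathbb K)$ the Hermitian ones. $\|\cdot\|_F$ is the Frobenius norm, $\|\cdot\|_{op}$ the operator norm, $\|\cdot\|$ the Euclidean norm. $\Theta_+=\{\theta\in\mathbb H_d(\mathbb C):\mathrm{tr}(\theta)=1,\ \theta\succeq0\}$. The sampling operator is $\mathcal X\theta=(\mathrm{tr}(X^1\theta),\dots,\mathrm{tr}(X^n\theta))^T$ and $Y=(Y_1,\dots,Y_n)^T$. The variance $\sigma^2>0$ is assumed known (and bounded by a known constant). Residual sum of squares statistic: $$\hat r_n=\frac1n\|Y-\mathcal X\tilde\theta\|^2-\sigma^2 .$$ Quantile constants: for $0<\beta<1$, $\xi_{\beta,\sigma}$ is such that $\Pr\big(-\sum_{i=1}^n(\varepsilon_i^2-\sigma^2)>\xi_{\beta,\sigma}\sqrt n\big)=\beta$, and $z_\beta=\log(3/\beta)$. Confidence set: for $z\ge0$, $$C_n=\left\{u\in\mathbb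 H_d(\mathbb C):\ \|u-\tilde\theta\|_F^2\le2\left(\hat r_n+z\frac dn+\frac{\bar z(u)+\xi_{\alpha/3,\sigma}}{\sqrt n}\right)\right\},$$ where $\bar z(u)\ge0$ is given by $\bar z(u)^2=z_{\alpha/3}\,\sigma^2\max\big(3\|u-\tilde\theta\|_F^2,\ 4zd/n\big)$. *)

theory Defs
  imports
    "HOL-Probability.Probability"
    "Jordan_Normal_Form.Schur_Decomposition"
begin

section \<open>Matrices\<close>

(* The dimension d has to be a natural number (and not a type), since the constant in the
   coverage bound is uniform in d; hence the carrier-based matrices of Jordan_Normal_Form. *)

definition mtrace :: "'a::comm_monoid_add mat \<Rightarrow> 'a" where
  "mtrace A = (\<Sum>i<dim_row A. A $$ (i, i))"

definition frob_norm :: "'a::real_normed_vector mat \<Rightarrow> real" where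
  "frob_norm A = sqrt (\<Sum>i<dim_row A. \<Sum>j<dim_col A. (norm (A $$ (i, j)))\<^sup>2)"

definition vec_l2_norm :: "complex Matrix.vec \<Rightarrow> real" where
  "vec_l2_norm v = sqrt (\<Sum>i<dim_vec v. (cmod (vec_index v i))\<^sup>2)"

definition op_norm :: "complex mat \<Rightarrow> real" where
  "op_norm A = (SUP v \<in> {v \<in> carrier_vec (dim_col A). vec_l2_norm v \<le> 1}. vec_l2_norm (A *\<^sub>v v))"

definition hermitian_mats :: "nat \<Rightarrow> complex mat set" where
  "hermitian_mats d = {A \<in> carrier_mat d d. mat_adjoint A = A}"

(* mat_adjoint A = A makes the quadratic form real, so only its real part matters. *)
definition positive_semidef :: "nat \<Rightarrow> complex mat \<Rightarrow> bool" where
  "positive_semidef d A \<longleftrightarrow>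
     A \<in> hermitian_mats d \<and> (\<forall>v \<in> carrier_vec d. 0 \<le> Re ((A *\<^sub>v v) \<bullet>c v))"

definition quantum_states :: "nat \<Rightarrow> complex mat set" where
  "quantum_states d = {\<theta> \<in> hermitian_mats d. mtrace \<theta> = 1 \<and> positive_semidef d \<theta>}"

definition real_entries :: "complex mat \<Rightarrow> bool" where
  "real_entries A \<longleftrightarrow> (\<forall>i<dim_row A. \<forall>j<dim_col A. A $$ (i, j) \<in> \<real>)"

definition hermitian_onb :: "nat \<Rightarrow> (nat \<Rightarrow> complex mat) \<Rightarrow> bool" where
  "hermitian_onb d E \<longleftrightarrow>
     (\<forall>j<d\<^sup>2. E j \<in> hermitian_mats d) \<and>
     (\<forall>i<d\<^sup>2. \<forall>j<d\<^sup>2. mtrace (mat_adjoint (E i) * E j) = (if i = j then 1 else 0)) \<and>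
     (\<forall>A \<in> carrier_mat d d. \<exists>a. \<forall>m<d. \<forall>k<d. A $$ (m, k) = (\<Sum>j<d\<^sup>2. a j * E j $$ (m, k)))"


section \<open>The statistical model\<close>

(* Matrices carry no Borel structure in the library: use the sigma-algebra generated by the entries. *)
definition mat_space :: "nat \<Rightarrow> complex mat measure" where
  "mat_space d = vimage_algebra (carrier_mat d d) (\<lambda>A. \<lambda>p\<in>{..<d} \<times> {..<d}. A $$ p)
     (\<Pi>\<^sub>M p\<in>{..<d} \<times> {..<d}. borel)"

definition iid_entries :: "nat \<Rightarrow> real measure \<Rightarrow> (nat \<times> nat \<Rightarrow> real) measure" where
  "iid_entries d \<mu> = (\<Pi>\<^sub>M p\<in>{..<d} \<times> {..<d}. \<mu>)"

definition iid_entries_design :: "nat \<Rightarrow> real measure \<Rightarrow> complex mat measure" where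
  "iid_entries_design d \<mu> =
     distr (iid_entries d \<mu>) (mat_space d) (\<lambda>x. Matrix.mat d d (\<lambda>p. complex_of_real (x p)))"

definition centered_unit_variance :: "real measure \<Rightarrow> bool" where
  "centered_unit_variance \<mu> \<longleftrightarrow> prob_space \<mu> \<and> sets \<mu> = sets borel \<and>
     integrable \<mu> (\<lambda>x. x) \<and> (\<integral>x. x \<partial>\<mu>) = 0 \<and>
     integrable \<mu> (\<lambda>x. x\<^sup>2) \<and> (\<integral>x. x\<^sup>2 \<partial>\<mu>) = 1"

(* A nonnegative integral, so that the bound also asserts that the expectation is finite. *)
definition subgaussian_design :: "nat \<Rightarrow> real measure \<Rightarrow> real \<Rightarrow> real \<Rightarrow> bool" where
  "subgaussian_design d \<mu> \<tau>1 \<tau>2 \<longleftrightarrow>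
     (\<forall>M::real mat. M \<in> carrier_mat d d \<longrightarrow> frob_norm M \<le> 1 \<longrightarrow>
       (\<forall>l::real. (\<integral>\<^sup>+ x. ennreal (exp (l * mtrace (Matrix.mat d d x * M))) \<partial>iid_entries d \<mu>)
                   \<le> ennreal (\<tau>1 * exp (l\<^sup>2 * \<tau>2\<^sup>2))))"

definition basis_design :: "nat \<Rightarrow> (nat \<Rightarrow> complex mat) \<Rightarrow> complex mat measure" where
  "basis_design d E =
     distr (measure_pmf (pmf_of_set {..<d\<^sup>2})) (mat_space d) (\<lambda>j. of_nat d \<cdot>\<^sub>m E j)"

definition gaussian :: "real \<Rightarrow> real measure" where
  "gaussian \<sigma> = density lborel (\<lambda>x. ennreal (normal_density 0 \<sigma> x))"

definition noise :: "nat \<Rightarrow> real \<Rightarrow> (nat \<Rightarrow> real) measure" where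
  "noise n \<sigma> = (\<Pi>\<^sub>M i\<in>{..<n}. gaussian \<sigma>)"

definition sampling :: "(nat \<Rightarrow> complex mat) \<Rightarrow> complex mat \<Rightarrow> nat \<Rightarrow> complex" where
  "sampling X \<theta> i = mtrace (X i * \<theta>)"

(* The joint law of (Y, X), where D is the law of a single design matrix. The product measures
   express that the design matrices are i.i.d. and independent of the noise. Y is formally complex
   because the trace is; in both designs considered the traces are in fact real. *)
definition model_law ::
  "nat \<Rightarrow> complex mat measure \<Rightarrow> real \<Rightarrow> complex mat \<Rightarrow>
     ((nat \<Rightarrow> complex) \<times> (nat \<Rightarrow> complex mat)) measure" where
  "model_law n D \<sigma> \<theta> =
     distr (noise n \<sigma> \<Otimes>\<^sub>M (\<Pi>\<^sub>M i\<in>{..<n}. D))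
       ((\<Pi>\<^sub>M i\<in>{..<n}. borel) \<Otimes>\<^sub>M (\<Pi>\<^sub>M i\<in>{..<n}. D))
       (\<lambda>(e, X). (\<lambda>i\<in>{..<n}. sampling X \<theta> i + complex_of_real (e i), X))"


section \<open>The confidence set\<close>

definition rss :: "nat \<Rightarrow> (nat \<Rightarrow> complex) \<Rightarrow> (nat \<Rightarrow> complex mat) \<Rightarrow> real \<Rightarrow> complex mat \<Rightarrow> real" where
  "rss n Y X \<sigma> \<theta>t = (1 / real n) * (\<Sum>i<n. (cmod (Y i - sampling X \<theta>t i))\<^sup>2) - \<sigma>\<^sup>2"

(* The (1 - beta)-quantile of the centred, negated noise energy; the law of the noise is continuous,
   so exact equality is attainable and determines xi. *)
definition is_xi :: "nat \<Rightarrow> real \<Rightarrow> real \<Rightarrow> real \<Rightarrow> bool" where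
  "is_xi n \<sigma> \<beta> \<xi> \<longleftrightarrow>
     measure (noise n \<sigma>)
       {e \<in> space (noise n \<sigma>). - (\<Sum>i<n. (e i)\<^sup>2 - \<sigma>\<^sup>2) > \<xi> * sqrt (real n)} = \<beta>"

definition z_const :: "real \<Rightarrow> real" where
  "z_const \<beta> = ln (3 / \<beta>)"

definition zbar ::
  "nat \<Rightarrow> nat \<Rightarrow> real \<Rightarrow> real \<Rightarrow> real \<Rightarrow> complex mat \<Rightarrow> complex mat \<Rightarrow> real" where
  "zbar n d \<sigma> \<alpha> z \<theta>t u =
     sqrt (z_const (\<alpha> / 3) * \<sigma>\<^sup>2 * max (3 * (frob_norm (u - \<theta>t))\<^sup>2) (4 * z * real d / real n))"

(* xi stands for the quantile constant at level alpha/3. *)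
definition conf_set ::
  "nat \<Rightarrow> nat \<Rightarrow> real \<Rightarrow> real \<Rightarrow> real \<Rightarrow> real \<Rightarrow> complex mat \<Rightarrow>
     (nat \<Rightarrow> complex) \<times> (nat \<Rightarrow> complex mat) \<Rightarrow> complex mat set" where
  "conf_set n d \<sigma> \<alpha> \<xi> z \<theta>t = (\<lambda>(Y, X).
     {u \<in> hermitian_mats d.
        (frob_norm (u - \<theta>t))\<^sup>2 \<le>
          2 * (rss n Y X \<sigma> \<theta>t + z * real d / real n + (zbar n d \<sigma> \<alpha> z \<theta>t u + \<xi>) / sqrt (real n))})"

definition coverage ::
  "nat \<Rightarrow> nat \<Rightarrow> complex mat measure \<Rightarrow> real \<Rightarrow> real \<Rightarrow> real \<Rightarrow> real \<Rightarrow> complex mat \<Rightarrow> complex mat \<Rightarrow> real"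
  where
  "coverage n d D \<sigma> \<alpha> \<xi> z \<theta>t \<theta> =
     measure (model_law n D \<sigma> \<theta>)
       {\<omega> \<in> space (model_law n D \<sigma> \<theta>). \<theta> \<in> conf_set n d \<sigma> \<alpha> \<xi> z \<theta>t \<omega>}"

end

theory Submission
  imports Defs
begin

text \<open>
  Put \<open>\<Delta> = \<theta> - \<theta>t\<close>, let \<open>w\<close> be the vector of the real parts of \<open>tr (X i \<Delta>)\<close>, \<open>A\<close> its squared
  length, \<open>F\<close> the squared Frobenius norm of \<open>\<Delta>\<close>, \<open>G = n F - 2 z d\<close>, \<open>D = sqrt n * zbar\<close>, and
  \<open>R = n \<sigma>\<^sup>2 - sqrt n * \<xi>\<close>. Multiplying the inequality that defines the confidence set by \<open>n / 2\<close>, one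
  sees that \<open>\<theta>\<close> is missed only if the noise \<open>e\<close> satisfies \<open>|w + e|\<^sup>2 < R + G / 2 - D\<close>, whereas \<open>\<xi>\<close> is
  chosen so that \<open>|e|\<^sup>2 < R\<close> has probability \<open>\<alpha> / 3\<close>.

  Expanding the square and bounding the cross term \<open>2 <w, e>\<close> on its own is not enough: for a weak
  signal with \<open>A\<close> close to \<open>n F\<close>, the allowance \<open>D\<close> only makes the cross term harmless up to a
  probability of order \<open>\<alpha> powr (3 / 8)\<close>. Two regimes are therefore separated.

  \<^item> Weak signal, \<open>G / 2 \<le> D\<close>: missing implies \<open>|w + e|\<^sup>2 < R\<close>. A centred Gaussian vector gives a ball
    its largest probability when the ball is centred at the origin, so this is at most \<open>\<alpha> / 3\<close>,
    whatever the design is (\<open>noncoverage_small_signal\<close>).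
  \<^item> Strong signal, \<open>G / 2 > D\<close>: for \<open>A\<close> near its mean \<open>n F\<close>, the slack \<open>A - G / 2\<close> now exceeds the
    allowance \<open>D\<close> and adds to it. If \<open>2 A \<ge> G\<close>, the conditional probability of a miss is at most
    \<open>\<alpha> / 3 + exp (- 3 L A / (2 G))\<close> with \<open>L = ln (9 / \<alpha>)\<close> (\<open>noncoverage_large_signal\<close>), and this is at
    most \<open>4 \<alpha> / 9\<close> as soon as \<open>A \<ge> 2 G / 3\<close>.

  What remains is the lower tail of \<open>A\<close>, a sum of \<open>n\<close> independent copies of a square with mean \<open>F\<close>. As
  squares are nonnegative, a second and a fourth moment suffice for an exponential bound
  (\<open>nn_integral_exp_neg_square_le\<close>, \<open>PiM_sum_squares_lower_tail\<close>). The sub-Gaussian hypothesis bounds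
  the fourth moment by a multiple of \<open>F\<^sup>2\<close>. For the basis design Parseval's identity gives the second
  moment, and the fourth moment is at most \<open>4 K\<^sup>2 d F\<close>, since \<open>|tr (E \<theta>)|\<close> is at most the operator norm
  of \<open>E\<close> for every state \<open>\<theta>\<close> (\<open>quantum_state_trace_le_op_norm\<close>); the resulting exponent
  \<open>(n F + 4 z d)\<^sup>2 / (72 n K\<^sup>2 d F)\<close> is at least \<open>2 z / (9 K\<^sup>2)\<close> by the inequality of arithmetic and
  geometric means. For the Gaussian design the constant \<open>1 / 24\<close> is obtained from the exact Laplace
  transform of a squared normal variable, which is used once for the lower tail of \<open>A\<close> at \<open>G / 2\<close> and
  once to average \<open>exp (- 3 L A / (2 G))\<close> over the design.
\<close>

section \<open>One-dimensional Gaussian integrals\<close>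

lemma sets_gaussian[measurable_cong, simp]: "sets (gaussian \<sigma>) = sets borel"
  by (simp add: gaussian_def)

lemma space_gaussian[simp]: "space (gaussian \<sigma>) = UNIV"
  by (simp add: gaussian_def)

lemma prob_space_gaussian: "\<sigma> > 0 \<Longrightarrow> prob_space (gaussian \<sigma>)"
  unfolding gaussian_def by (rule prob_space_normal_density)

lemma nn_integral_gaussian:
  assumes [measurable]: "f \<in> borel_measurable borel"
  shows "(\<integral>\<^sup>+ x. f x \<partial>gaussian \<sigma>) = (\<integral>\<^sup>+ x. ennreal (normal_density 0 \<sigma> x) * f x \<partial>lborel)"
  unfolding gaussian_def by (rule nn_integral_density) auto

lemma nn_integral_normal_density: "\<sigma> > 0 \<Longrightarrow> (\<integral>\<^sup>+ x. ennreal (normal_density m \<sigma> x) \<partial>lborel) = 1"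
  by (simp add: nn_integral_eq_integral)

text \<open>Completing the square: tilting a centred normal density by \<open>exp (t x)\<close> shifts its mean to \<open>\<sigma>\<^sup>2 t\<close>.\<close>

lemma gaussian_mgf:
  assumes "\<sigma> > 0"
  shows "(\<integral>\<^sup>+ x. ennreal (exp (t * x)) \<partial>gaussian \<sigma>) = ennreal (exp (\<sigma>\<^sup>2 * t\<^sup>2 / 2))"
proof -
  have "normal_density 0 \<sigma> x * exp (t * x) = exp (\<sigma>\<^sup>2 * t\<^sup>2 / 2) * normal_density (\<sigma>\<^sup>2 * t) \<sigma> x" for x
  proof -
    have "- (x - 0)\<^sup>2 / (2 * \<sigma>\<^sup>2) + t * x = \<sigma>\<^sup>2 * t\<^sup>2 / 2 + - (x - \<sigma>\<^sup>2 * t)\<^sup>2 / (2 * \<sigma>\<^sup>2)"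
      using assms by (simp add: field_simps power2_eq_square)
    then have "exp (- (x - 0)\<^sup>2 / (2 * \<sigma>\<^sup>2)) * exp (t * x)
        = exp (\<sigma>\<^sup>2 * t\<^sup>2 / 2) * exp (- (x - \<sigma>\<^sup>2 * t)\<^sup>2 / (2 * \<sigma>\<^sup>2))"
      by (simp only: exp_add[symmetric])
    then show ?thesis
      unfolding normal_density_def by (simp add: field_simps)
  qed
  then have "(\<integral>\<^sup>+ x. ennreal (exp (t * x)) \<partial>gaussian \<sigma>)
      = (\<integral>\<^sup>+ x. ennreal (exp (\<sigma>\<^sup>2 * t\<^sup>2 / 2)) * ennreal (normal_density (\<sigma>\<^sup>2 * t) \<sigma> x) \<partial>lborel)"
    by (subst nn_integral_gaussian) (auto simp: ennreal_mult[symmetric])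
  also have "\<dots> = ennreal (exp (\<sigma>\<^sup>2 * t\<^sup>2 / 2))"
    using assms by (simp add: nn_integral_cmult nn_integral_normal_density)
  finally show ?thesis .
qed

text \<open>
  Tilting the standard normal density by the exponential of a negative square gives a multiple of
  another normal density. The right-hand side has again the shape \<open>exp (- l' w\<^sup>2)\<close>, so that the
  coordinates of a product measure can be integrated out one after the other.
\<close>

lemma gaussian_exp_neg_square:
  assumes "l \<ge> 0"
  shows "(\<integral>\<^sup>+ y. ennreal (exp (- l * (m * y + w)\<^sup>2)) \<partial>gaussian 1)
    = ennreal (1 / sqrt (1 + 2 * l * m\<^sup>2) * exp (- (l / (1 + 2 * l * m\<^sup>2)) * w\<^sup>2))"
proof -
  define a where "a = 1 + 2 * l * m\<^sup>2"
  have a: "a > 0" using assms by (simp add: a_def add_pos_nonneg)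
  define C where "C = 1 / sqrt a * exp (- (l / a) * w\<^sup>2)"
  have "normal_density 0 1 y * exp (- l * (m * y + w)\<^sup>2)
      = C * normal_density (- 2 * l * w * m / a) (1 / sqrt a) y" for y
  proof -
    have "- y\<^sup>2 / 2 + - l * (m * y + w)\<^sup>2
        = - (l / a) * w\<^sup>2 + - (y - (- 2 * l * w * m / a))\<^sup>2 / (2 * (1 / sqrt a)\<^sup>2)"
    proof -
      have "2 * l * m\<^sup>2 = a - 1" by (simp add: a_def)
      have "- (l / a) * w\<^sup>2 + - (y - (- 2 * l * w * m / a))\<^sup>2 / (2 * (1 / sqrt a)\<^sup>2)
        = - (l / a) * w\<^sup>2 - a / 2 * (y + 2 * l * w * m / a)\<^sup>2"
        using a by (simp add: power_divide)
      also have "\<dots> = - (l * w\<^sup>2) * ((1 + 2 * l * m\<^sup>2) / a) - a / 2 * y\<^sup>2 - 2 * l * w * m * y"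
        using a by (simp add: field_simps power2_eq_square)
      also have "\<dots> = - y\<^sup>2 / 2 + - l * (m * y + w)\<^sup>2"
        unfolding a_def[symmetric] using a
        by (simp, simp add: a_def field_simps power2_eq_square)
      finally show ?thesis by simp
    qed
    then have "exp (- y\<^sup>2 / 2) * exp (- l * (m * y + w)\<^sup>2)
        = exp (- (l / a) * w\<^sup>2) * exp (- (y - (- 2 * l * w * m / a))\<^sup>2 / (2 * (1 / sqrt a)\<^sup>2))"
      by (simp only: exp_add[symmetric])
    moreover have "1 / sqrt (2 * pi * (1 / sqrt a)\<^sup>2) = sqrt a / sqrt (2 * pi)"
      using a by (simp add: power_divide real_sqrt_divide)
    ultimately show ?thesis
      unfolding normal_density_def C_def using a by (simp add: field_simps)
  qed
  then have "(\<integral>\<^sup>+ y. ennreal (exp (- l * (m * y + w)\<^sup>2)) \<partial>gaussian 1)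
      = (\<integral>\<^sup>+ y. ennreal C * ennreal (normal_density (- 2 * l * w * m / a) (1 / sqrt a) y) \<partial>lborel)"
    using a by (subst nn_integral_gaussian) (auto simp: ennreal_mult[symmetric] C_def)
  also have "\<dots> = ennreal C"
    using a by (simp add: nn_integral_cmult nn_integral_normal_density)
  finally show ?thesis by (simp add: C_def a_def)
qed

text \<open>
  The one-dimensional case of the fact that centring an interval maximises its Gaussian measure. Both
  intervals have the same length; the density exceeds its value at the end point \<open>a\<close> inside the
  centred interval and is below that value outside, so trading one interval for the other can only
  gain.
\<close>

lemma gaussian_shifted_ball_le:
  assumes "\<sigma> > 0"
  shows "(\<integral>\<^sup>+ y. indicator {y. (w + y)\<^sup>2 < r} y \<partial>gaussian \<sigma>)
    \<le> (\<integral>\<^sup>+ y. indicator {y. y\<^sup>2 < r} y \<partial>gaussian \<sigma>)"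
proof (cases "r > 0")
  case False
  then have "\<not> u\<^sup>2 < r" for u :: real
    using zero_le_power2[of u] by linarith
  then show ?thesis by simp
next
  case True
  define a where "a = sqrt r"
  have a: "a > 0" "a\<^sup>2 = r" using True by (auto simp: a_def)
  have lt: "u\<^sup>2 < r \<longleftrightarrow> \<bar>u\<bar> < a" for u
    unfolding a_def by (metis real_sqrt_abs real_sqrt_less_iff)
  define A where "A = {- a - w<..<a - w}"
  define B where "B = {- a<..<a}"
  have AB: "{y. (w + y)\<^sup>2 < r} = A" "{y. y\<^sup>2 < r} = B"
    by (auto simp: lt A_def B_def)
  let ?p = "normal_density 0 \<sigma>"
  have "0 < ?p a" by (rule normal_density_pos[OF assms])
  have mono: "?p x \<le> ?p y" if "\<bar>y\<bar> \<le> \<bar>x\<bar>" for x y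
  proof -
    have "y\<^sup>2 \<le> x\<^sup>2" using that by (simp add: abs_le_square_iff)
    then show ?thesis
      using assms by (auto simp: normal_density_def divide_simps mult_left_mono)
  qed
  \<comment> \<open>Pointwise, \<open>(1\<^bsub>A\<^esub> - 1\<^bsub>B\<^esub>) (p - p a) \<le> 0\<close>, with all terms moved to the side where they are positive.\<close>
  have pt: "ennreal (?p y) * indicator A y + ennreal (?p a) * indicator B y
      \<le> ennreal (?p y) * indicator B y + ennreal (?p a) * indicator A y" for y
  proof -
    have "y \<in> B \<Longrightarrow> ?p a \<le> ?p y" by (rule mono) (auto simp: B_def)
    moreover have "y \<notin> B \<Longrightarrow> ?p y \<le> ?p a" by (rule mono) (use a in \<open>auto simp: B_def\<close>)
    ultimately show ?thesis by (auto simp: indicator_def ennreal_leI add.commute)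
  qed
  have [measurable]: "A \<in> sets borel" "B \<in> sets borel" by (auto simp: A_def B_def)
  have eqv: "emeasure lborel A = emeasure lborel B"
    using a by (simp add: A_def B_def)
  have "(\<integral>\<^sup>+ y. ennreal (?p y) * indicator A y \<partial>lborel) + ennreal (?p a) * emeasure lborel B
      \<le> (\<integral>\<^sup>+ y. ennreal (?p y) * indicator B y \<partial>lborel) + ennreal (?p a) * emeasure lborel A"
  proof -
    have "(\<integral>\<^sup>+ y. ennreal (?p y) * indicator A y + ennreal (?p a) * indicator B y \<partial>lborel)
        \<le> (\<integral>\<^sup>+ y. ennreal (?p y) * indicator B y + ennreal (?p a) * indicator A y \<partial>lborel)"
      by (rule nn_integral_mono) (rule pt)
    then show ?thesis
      by (simp add: nn_integral_add nn_integral_cmult_indicator)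
  qed
  moreover have "ennreal (?p a) * emeasure lborel B \<noteq> \<infinity>"
    using a by (simp add: B_def ennreal_mult_eq_top_iff)
  ultimately have "(\<integral>\<^sup>+ y. ennreal (?p y) * indicator A y \<partial>lborel)
      \<le> (\<integral>\<^sup>+ y. ennreal (?p y) * indicator B y \<partial>lborel)"
    using ennreal_add_left_cancel_le[of "ennreal (?p a) * emeasure lborel B"]
    by (simp only: eqv add.commute[of _ "ennreal (?p a) * emeasure lborel B"]) simp
  then show ?thesis
    unfolding AB by (subst (1 2) nn_integral_gaussian) auto
qed

section \<open>Gaussian noise vectors\<close>

lemma product_sigma_finite_gaussian: "\<sigma> > 0 \<Longrightarrow> product_sigma_finite (\<lambda>_. gaussian \<sigma>)"
  by (simp add: product_sigma_finite_def prob_space_gaussian prob_space_imp_sigma_finite)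

lemma prob_space_noise: "\<sigma> > 0 \<Longrightarrow> prob_space (noise n \<sigma>)"
  unfolding noise_def by (rule prob_space_PiM) (rule prob_space_gaussian)

text \<open>
  Anderson's inequality for Euclidean balls, one coordinate at a time: with the other coordinates fixed,
  a slice of a ball is an interval, to which the one-dimensional inequality applies; then the order of
  integration is exchanged and the induction hypothesis removes the remaining shifts.
\<close>

lemma PiM_gaussian_shifted_ball_le:
  assumes "finite I" and \<sigma>: "\<sigma> > 0"
  shows "(\<integral>\<^sup>+ e. indicator {e. (\<Sum>i\<in>I. (w i + e i)\<^sup>2) < r} e \<partial>(\<Pi>\<^sub>M i\<in>I. gaussian \<sigma>))
    \<le> (\<integral>\<^sup>+ e. indicator {e. (\<Sum>i\<in>I. (e i)\<^sup>2) < r} e \<partial>(\<Pi>\<^sub>M i\<in>I. gaussian \<sigma>))"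
  using assms(1)
proof (induction I arbitrary: r)
  case empty
  show ?case by simp
next
  case (insert i J)
  interpret product_sigma_finite "\<lambda>_. gaussian \<sigma>"
    by (rule product_sigma_finite_gaussian[OF \<sigma>])
  have upd: "(\<Sum>j\<in>J. f j ((x(i := y)) j)) = (\<Sum>j\<in>J. f j (x j))" for f :: "'a \<Rightarrow> real \<Rightarrow> real" and x y
    using insert.hyps by (intro sum.cong) auto
  have "(\<integral>\<^sup>+ e. indicator {e. (\<Sum>j\<in>insert i J. (w j + e j)\<^sup>2) < r} e \<partial>(\<Pi>\<^sub>M i\<in>insert i J. gaussian \<sigma>))
      = (\<integral>\<^sup>+ x. \<integral>\<^sup>+ y. indicator {y. (w i + y)\<^sup>2 < r - (\<Sum>j\<in>J. (w j + x j)\<^sup>2)} y \<partial>gaussian \<sigma>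
          \<partial>(\<Pi>\<^sub>M i\<in>J. gaussian \<sigma>))"
    using insert.hyps
    by (subst product_nn_integral_insert; (intro nn_integral_cong)?)
       (simp_all add: indicator_def upd[of "\<lambda>j t. (w j + t)\<^sup>2"] less_diff_eq add_ac del: fun_upd_apply add: fun_upd_same)
  also have "\<dots> \<le> (\<integral>\<^sup>+ x. \<integral>\<^sup>+ y. indicator {y. y\<^sup>2 < r - (\<Sum>j\<in>J. (w j + x j)\<^sup>2)} y \<partial>gaussian \<sigma>
          \<partial>(\<Pi>\<^sub>M i\<in>J. gaussian \<sigma>))"
    by (intro nn_integral_mono gaussian_shifted_ball_le \<sigma>)
  also have "\<dots> = (\<integral>\<^sup>+ e. indicator {e. (e i)\<^sup>2 + (\<Sum>j\<in>J. (w j + e j)\<^sup>2) < r} e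
      \<partial>(\<Pi>\<^sub>M i\<in>insert i J. gaussian \<sigma>))"
    using insert.hyps
    by (subst product_nn_integral_insert; (intro nn_integral_cong)?)
       (simp_all add: indicator_def upd[of "\<lambda>j t. (w j + t)\<^sup>2"] less_diff_eq add_ac del: fun_upd_apply add: fun_upd_same)
  also have "\<dots> = (\<integral>\<^sup>+ y. \<integral>\<^sup>+ x. indicator {x. (\<Sum>j\<in>J. (w j + x j)\<^sup>2) < r - y\<^sup>2} x
      \<partial>(\<Pi>\<^sub>M i\<in>J. gaussian \<sigma>) \<partial>gaussian \<sigma>)"
    using insert.hyps
    by (subst product_nn_integral_insert_rev; (intro nn_integral_cong)?)
       (simp_all add: indicator_def upd[of "\<lambda>j t. (w j + t)\<^sup>2"] less_diff_eq add_ac del: fun_upd_apply add: fun_upd_same)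
  also have "\<dots> \<le> (\<integral>\<^sup>+ y. \<integral>\<^sup>+ x. indicator {x. (\<Sum>j\<in>J. (x j)\<^sup>2) < r - y\<^sup>2} x
      \<partial>(\<Pi>\<^sub>M i\<in>J. gaussian \<sigma>) \<partial>gaussian \<sigma>)"
    by (intro nn_integral_mono insert.IH)
  also have "\<dots> = (\<integral>\<^sup>+ e. indicator {e. (\<Sum>j\<in>insert i J. (e j)\<^sup>2) < r} e
      \<partial>(\<Pi>\<^sub>M i\<in>insert i J. gaussian \<sigma>))"
    using insert.hyps
    by (subst product_nn_integral_insert_rev; (intro nn_integral_cong)?)
       (simp_all add: indicator_def upd[of "\<lambda>j t. t\<^sup>2"] less_diff_eq add_ac del: fun_upd_apply add: fun_upd_same)
  finally show ?case .
qed

lemma PiM_gaussian_linear_mgf: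
  assumes "finite I" and \<sigma>: "\<sigma> > 0"
  shows "(\<integral>\<^sup>+ e. ennreal (exp (\<Sum>i\<in>I. t i * e i)) \<partial>(\<Pi>\<^sub>M i\<in>I. gaussian \<sigma>))
    = ennreal (exp (\<sigma>\<^sup>2 * (\<Sum>i\<in>I. (t i)\<^sup>2) / 2))"
proof -
  interpret product_sigma_finite "\<lambda>_. gaussian \<sigma>"
    by (rule product_sigma_finite_gaussian[OF \<sigma>])
  have "(\<integral>\<^sup>+ e. ennreal (exp (\<Sum>i\<in>I. t i * e i)) \<partial>(\<Pi>\<^sub>M i\<in>I. gaussian \<sigma>))
      = (\<integral>\<^sup>+ e. (\<Prod>i\<in>I. ennreal (exp (t i * e i))) \<partial>(\<Pi>\<^sub>M i\<in>I. gaussian \<sigma>))"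
    using assms(1) by (simp add: exp_sum prod_ennreal)
  also have "\<dots> = (\<Prod>i\<in>I. \<integral>\<^sup>+ y. ennreal (exp (t i * y)) \<partial>gaussian \<sigma>)"
    using assms(1) by (intro product_nn_integral_prod) auto
  also have "\<dots> = ennreal (exp (\<sigma>\<^sup>2 * (\<Sum>i\<in>I. (t i)\<^sup>2) / 2))"
    using assms(1) by (simp add: gaussian_mgf[OF \<sigma>] prod_ennreal exp_sum[symmetric]
        sum_distrib_left sum_divide_distrib)
  finally show ?thesis .
qed

text \<open>
  Chernoff's bound for a normal variable of variance \<open>4 \<sigma>\<^sup>2 A\<close>, with \<open>A\<close> the sum of the squared
  coefficients; the exponent \<open>l = m / (4 \<sigma>\<^sup>2 A)\<close> is the minimiser.
\<close>

lemma PiM_gaussian_linear_tail: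
  assumes "finite I" and \<sigma>: "\<sigma> > 0" and m: "m \<ge> 0" and A: "(\<Sum>i\<in>I. (w i)\<^sup>2) > 0"
  shows "emeasure (\<Pi>\<^sub>M i\<in>I. gaussian \<sigma>)
      {e \<in> space (\<Pi>\<^sub>M i\<in>I. gaussian \<sigma>). m + 2 * (\<Sum>i\<in>I. w i * e i) < 0}
    \<le> ennreal (exp (- m\<^sup>2 / (8 * \<sigma>\<^sup>2 * (\<Sum>i\<in>I. (w i)\<^sup>2))))"
proof -
  define A where "A = (\<Sum>i\<in>I. (w i)\<^sup>2)"
  define l where "l = m / (4 * \<sigma>\<^sup>2 * A)"
  have A0: "A > 0" using A by (simp add: A_def)
  have l: "l \<ge> 0" using m \<sigma> A0 by (simp add: l_def)
  let ?P = "\<Pi>\<^sub>M i\<in>I. gaussian \<sigma>"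
  have "emeasure ?P {e \<in> space ?P. m + 2 * (\<Sum>i\<in>I. w i * e i) < 0}
      = (\<integral>\<^sup>+ e. indicator {e \<in> space ?P. m + 2 * (\<Sum>i\<in>I. w i * e i) < 0} e \<partial>?P)"
    by (rule nn_integral_indicator[symmetric]) measurable
  also have "\<dots> \<le> (\<integral>\<^sup>+ e. ennreal (exp (- l * m)) * ennreal (exp (\<Sum>i\<in>I. (- 2 * l * w i) * e i)) \<partial>?P)"
  proof (rule nn_integral_mono)
    fix e
    have "1 \<le> exp (- l * m) * exp (\<Sum>i\<in>I. (- 2 * l * w i) * e i)"
      if "m + 2 * (\<Sum>i\<in>I. w i * e i) < 0"
    proof -
      have "0 \<le> l * - (m + 2 * (\<Sum>i\<in>I. w i * e i))"
        using l that by (intro mult_nonneg_nonneg) auto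
      also have "\<dots> = - l * m + (\<Sum>i\<in>I. (- 2 * l * w i) * e i)"
        by (simp add: algebra_simps sum_distrib_left sum_negf)
      finally show ?thesis by (simp add: exp_add[symmetric])
    qed
    then show "indicator {e \<in> space ?P. m + 2 * (\<Sum>i\<in>I. w i * e i) < 0} e
        \<le> ennreal (exp (- l * m)) * ennreal (exp (\<Sum>i\<in>I. (- 2 * l * w i) * e i))"
      by (auto simp: indicator_def ennreal_mult[symmetric])
  qed
  also have "\<dots> = ennreal (exp (- l * m) * exp (\<sigma>\<^sup>2 * (\<Sum>i\<in>I. (- 2 * l * w i)\<^sup>2) / 2))"
    by (subst nn_integral_cmult) (measurable, simp only: PiM_gaussian_linear_mgf[OF assms(1) \<sigma>] ennreal_mult exp_ge_zero)
  also have "(\<Sum>i\<in>I. (- 2 * l * w i)\<^sup>2) = 4 * l\<^sup>2 * A"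
    by (simp add: A_def sum_distrib_left power_mult_distrib)
  also have "exp (- l * m) * exp (\<sigma>\<^sup>2 * (4 * l\<^sup>2 * A) / 2) = exp (- m\<^sup>2 / (8 * \<sigma>\<^sup>2 * A))"
  proof -
    have "- l * m + \<sigma>\<^sup>2 * (4 * l\<^sup>2 * A) / 2 = - m\<^sup>2 / (8 * \<sigma>\<^sup>2 * A)"
      using A0 \<sigma> by (simp add: l_def field_simps power2_eq_square)
    then show ?thesis by (simp only: exp_add[symmetric])
  qed
  finally show ?thesis by (simp add: A_def)
qed

text \<open>
  The Laplace transform of the square of a normal variable with variance \<open>\<Sum>p\<in>I. (m p)\<^sup>2\<close>. Integrating
  one coordinate replaces \<open>l\<close> by \<open>l / (1 + 2 l m\<^sup>2)\<close>, and the prefactors telescope.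
\<close>

lemma PiM_gaussian_exp_neg_square:
  assumes "finite I" and "l \<ge> 0"
  shows "(\<integral>\<^sup>+ x. ennreal (exp (- l * (\<Sum>p\<in>I. m p * x p)\<^sup>2)) \<partial>(\<Pi>\<^sub>M p\<in>I. gaussian 1))
    = ennreal (1 / sqrt (1 + 2 * l * (\<Sum>p\<in>I. (m p)\<^sup>2)))"
  using assms
proof (induction I arbitrary: l)
  case empty
  show ?case by (simp add: PiM_empty)
next
  case (insert i J)
  interpret product_sigma_finite "\<lambda>_. gaussian 1"
    by (rule product_sigma_finite_gaussian) simp
  define a where "a = 1 + 2 * l * (m i)\<^sup>2"
  define S where "S = (\<Sum>p\<in>J. (m p)\<^sup>2)"
  have a: "a > 0" using insert.prems by (simp add: a_def add_pos_nonneg)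
  have S: "S \<ge> 0" by (simp add: S_def sum_nonneg)
  have upd: "(\<Sum>j\<in>J. m j * (x(i := y)) j) = (\<Sum>j\<in>J. m j * x j)" for x y
    using insert.hyps by (intro sum.cong) auto
  have "(\<integral>\<^sup>+ x. ennreal (exp (- l * (\<Sum>p\<in>insert i J. m p * x p)\<^sup>2)) \<partial>(\<Pi>\<^sub>M p\<in>insert i J. gaussian 1))
      = (\<integral>\<^sup>+ x. \<integral>\<^sup>+ y. ennreal (exp (- l * (m i * y + (\<Sum>p\<in>J. m p * x p))\<^sup>2)) \<partial>gaussian 1
          \<partial>(\<Pi>\<^sub>M p\<in>J. gaussian 1))"
    using insert.hyps by (subst product_nn_integral_insert) (simp_all add: upd del: fun_upd_apply add: fun_upd_same)
  also have "\<dots> = (\<integral>\<^sup>+ x. ennreal (1 / sqrt a) * ennreal (exp (- (l / a) * (\<Sum>p\<in>J. m p * x p)\<^sup>2))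
          \<partial>(\<Pi>\<^sub>M p\<in>J. gaussian 1))"
    using a by (subst gaussian_exp_neg_square[OF insert.prems]) (simp add: a_def ennreal_mult[symmetric])
  also have "\<dots> = ennreal (1 / sqrt a) * ennreal (1 / sqrt (1 + 2 * (l / a) * S))"
  proof -
    have ih: "(\<integral>\<^sup>+ x. ennreal (exp (- (l / a) * (\<Sum>p\<in>J. m p * x p)\<^sup>2)) \<partial>(\<Pi>\<^sub>M p\<in>J. gaussian 1))
        = ennreal (1 / sqrt (1 + 2 * (l / a) * S))"
      unfolding S_def using a insert.prems by (intro insert.IH) simp
    show ?thesis
      unfolding ih[symmetric] by (rule nn_integral_cmult) measurable
  qed
  also have "\<dots> = ennreal (1 / sqrt (a * (1 + 2 * (l / a) * S)))"
    using a S insert.prems by (simp add: ennreal_mult[symmetric] real_sqrt_mult)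
  also have "a * (1 + 2 * (l / a) * S) = a + 2 * l * S"
    using a by (simp add: field_simps)
  also have "a + 2 * l * S = 1 + 2 * l * (\<Sum>p\<in>insert i J. (m p)\<^sup>2)"
    using insert.hyps by (simp add: a_def S_def algebra_simps)
  finally show ?case .
qed

section \<open>Non-coverage for a fixed design\<close>

lemma noise_ball_prob:
  assumes "\<sigma> > 0" "is_xi n \<sigma> \<beta> \<xi>"
  shows "emeasure (noise n \<sigma>) {e \<in> space (noise n \<sigma>). (\<Sum>i<n. (e i)\<^sup>2) < real n * \<sigma>\<^sup>2 - sqrt (real n) * \<xi>}
    = ennreal \<beta>"
proof -
  interpret prob_space "noise n \<sigma>" by (rule prob_space_noise[OF assms(1)])
  have "- (\<Sum>i<n. (e i)\<^sup>2 - \<sigma>\<^sup>2) > \<xi> * sqrt (real n)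
      \<longleftrightarrow> (\<Sum>i<n. (e i)\<^sup>2) < real n * \<sigma>\<^sup>2 - sqrt (real n) * \<xi>" for e
    by (simp add: sum_subtractf algebra_simps)
  then show ?thesis
    using assms(2) unfolding is_xi_def by (simp add: emeasure_eq_measure)
qed

lemma noise_shifted_ball_le:
  assumes "\<sigma> > 0"
  shows "emeasure (noise n \<sigma>) {e \<in> space (noise n \<sigma>). (\<Sum>i<n. (w i + e i)\<^sup>2) < r}
    \<le> emeasure (noise n \<sigma>) {e \<in> space (noise n \<sigma>). (\<Sum>i<n. (e i)\<^sup>2) < r}"
proof -
  have eq: "emeasure (noise n \<sigma>) {e \<in> space (noise n \<sigma>). (\<Sum>i<n. (v i + e i)\<^sup>2) < r}
      = (\<integral>\<^sup>+ e. indicator {e. (\<Sum>i<n. (v i + e i)\<^sup>2) < r} e \<partial>noise n \<sigma>)" for v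
  proof -
    have "{e \<in> space (noise n \<sigma>). (\<Sum>i<n. (v i + e i)\<^sup>2) < r} \<in> sets (noise n \<sigma>)"
      unfolding noise_def by measurable
    then show ?thesis
      by (subst nn_integral_indicator[symmetric], assumption, intro nn_integral_cong)
         (simp add: indicator_def)
  qed
  show ?thesis
    using PiM_gaussian_shifted_ball_le[where I = "{..<n}" and w = w and r = r, OF finite_lessThan assms]
    unfolding eq eq[of "\<lambda>_. 0", simplified] unfolding noise_def .
qed

text \<open>
  Here the threshold does not exceed the quantile radius, and moving the centre of the ball away from
  the origin only lowers its probability.
\<close>

lemma noncoverage_small_signal:
  assumes \<sigma>: "\<sigma> > 0" and xi: "is_xi n \<sigma> \<beta> \<xi>" and "G / 2 \<le> D"
  shows "emeasure (noise n \<sigma>) {e \<in> space (noise n \<sigma>).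
      (\<Sum>i<n. (w i + e i)\<^sup>2) < real n * \<sigma>\<^sup>2 - sqrt (real n) * \<xi> + G / 2 - D} \<le> ennreal \<beta>"
proof -
  have meas: "{e \<in> space (noise n \<sigma>). (\<Sum>i<n. (v i + e i)\<^sup>2) < r} \<in> sets (noise n \<sigma>)" for v r
    unfolding noise_def by measurable
  have "emeasure (noise n \<sigma>) {e \<in> space (noise n \<sigma>).
      (\<Sum>i<n. (w i + e i)\<^sup>2) < real n * \<sigma>\<^sup>2 - sqrt (real n) * \<xi> + G / 2 - D}
    \<le> emeasure (noise n \<sigma>) {e \<in> space (noise n \<sigma>).
      (\<Sum>i<n. (w i + e i)\<^sup>2) < real n * \<sigma>\<^sup>2 - sqrt (real n) * \<xi>}"
    using assms(3) by (intro emeasure_mono subsetI meas) simp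
  also have "\<dots> \<le> ennreal \<beta>"
    unfolding noise_ball_prob[OF \<sigma> xi, symmetric] by (rule noise_shifted_ball_le[OF \<sigma>])
  finally show ?thesis .
qed

text \<open>
  Either the noise energy is below its quantile or \<open>m + 2 <w, e>\<close> is negative, where
  \<open>m = A - G / 2 + D\<close>. The case assumption says \<open>2 \<sigma> q \<le> 1\<close> for \<open>q = sqrt (3 L / G)\<close>, and then
  \<open>m - 2 \<sigma> q A\<close> is at least \<open>(A - G / 2) (1 - 2 \<sigma> q)\<close>, a product of nonnegative factors; hence
  \<open>m \<ge> 2 \<sigma> q A\<close>, which the Gaussian tail turns into the stated exponent.
\<close>

lemma noncoverage_large_signal:
  assumes \<sigma>: "\<sigma> > 0" and xi: "is_xi n \<sigma> \<beta> \<xi>" and L: "L \<ge> 0"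
    and big: "G / 2 > D" and D: "D \<ge> \<sigma> * sqrt (3 * L * G)" and D0: "D \<ge> 0"
    and A: "A = (\<Sum>i<n. (w i)\<^sup>2)" "2 * A \<ge> G"
  shows "emeasure (noise n \<sigma>) {e \<in> space (noise n \<sigma>).
      (\<Sum>i<n. (w i + e i)\<^sup>2) < real n * \<sigma>\<^sup>2 - sqrt (real n) * \<xi> + G / 2 - D}
    \<le> ennreal \<beta> + ennreal (exp (- (3 * L * A / (2 * G))))"
proof -
  define m where "m = A - G / 2 + D"
  have G: "G > 0" using big D0 by linarith
  have A0: "A > 0" using A G by linarith
  have m0: "m \<ge> 0" using A D0 by (simp add: m_def)
  define q where "q = sqrt (3 * L / G)"
  have q0: "q \<ge> 0" using L G by (simp add: q_def)
  have q2: "q\<^sup>2 = 3 * L / G" using L G by (simp add: q_def)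
  have qG: "sqrt (3 * L * G) = q * G"
  proof -
    have "(q * G)\<^sup>2 = 3 * L * G"
      using G by (simp add: power_mult_distrib q2) (simp add: power2_eq_square)
    then show ?thesis using q0 G by (metis abs_of_nonneg mult_nonneg_nonneg less_imp_le real_sqrt_abs)
  qed
  have "m \<ge> 2 * \<sigma> * A * q"
  proof -
    have "\<sigma> * (q * G) < G / 2" using big D qG by simp
    then have "\<sigma> * q < 1 / 2" using G by (simp add: mult.assoc[symmetric])
    then have "0 \<le> (A - G / 2) * (1 - 2 * (\<sigma> * q))"
      using A by (intro mult_nonneg_nonneg) auto
    also have "\<dots> = A - G / 2 + \<sigma> * (q * G) - 2 * \<sigma> * A * q"
      by (simp add: algebra_simps)
    finally show ?thesis using D qG by (simp add: m_def)
  qed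
  then have "(2 * \<sigma> * A * q)\<^sup>2 \<le> m\<^sup>2"
    using \<sigma> A0 q0 by (intro power_mono) auto
  then have "(2 * \<sigma> * A * q)\<^sup>2 / (8 * \<sigma>\<^sup>2 * A) \<le> m\<^sup>2 / (8 * \<sigma>\<^sup>2 * A)"
    using \<sigma> A0 by (intro divide_right_mono) auto
  moreover have "(2 * \<sigma> * A * q)\<^sup>2 / (8 * \<sigma>\<^sup>2 * A) = 3 * L * A / (2 * G)"
  proof -
    have "(2 * \<sigma> * A * q)\<^sup>2 / (8 * \<sigma>\<^sup>2 * A) = q\<^sup>2 * A / 2"
      using \<sigma> A0 by (simp add: field_simps power2_eq_square)
    then show ?thesis by (simp add: q2)
  qed
  ultimately have ex: "exp (- m\<^sup>2 / (8 * \<sigma>\<^sup>2 * A)) \<le> exp (- (3 * L * A / (2 * G)))"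
    by simp
  let ?N = "noise n \<sigma>"
  have meas: "{e \<in> space ?N. (\<Sum>i<n. (e i)\<^sup>2) < r} \<in> sets ?N"
       "{e \<in> space ?N. m + 2 * (\<Sum>i<n. w i * e i) < 0} \<in> sets ?N" for r
    unfolding noise_def by measurable
  have "emeasure ?N {e \<in> space ?N.
      (\<Sum>i<n. (w i + e i)\<^sup>2) < real n * \<sigma>\<^sup>2 - sqrt (real n) * \<xi> + G / 2 - D}
    \<le> emeasure ?N ({e \<in> space ?N. (\<Sum>i<n. (e i)\<^sup>2) < real n * \<sigma>\<^sup>2 - sqrt (real n) * \<xi>}
        \<union> {e \<in> space ?N. m + 2 * (\<Sum>i<n. w i * e i) < 0})"
  proof (intro emeasure_mono subsetI)
    fix e assume e: "e \<in> {e \<in> space ?N.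
      (\<Sum>i<n. (w i + e i)\<^sup>2) < real n * \<sigma>\<^sup>2 - sqrt (real n) * \<xi> + G / 2 - D}"
    have "(\<Sum>i<n. (w i + e i)\<^sup>2) = A + 2 * (\<Sum>i<n. w i * e i) + (\<Sum>i<n. (e i)\<^sup>2)"
      by (simp add: A(1) power2_sum sum.distrib sum_distrib_left algebra_simps)
    then show "e \<in> {e \<in> space ?N. (\<Sum>i<n. (e i)\<^sup>2) < real n * \<sigma>\<^sup>2 - sqrt (real n) * \<xi>}
        \<union> {e \<in> space ?N. m + 2 * (\<Sum>i<n. w i * e i) < 0}"
      using e by (auto simp: m_def)
  qed (simp add: meas sets.Un)
  also have "\<dots> \<le> emeasure ?N {e \<in> space ?N. (\<Sum>i<n. (e i)\<^sup>2) < real n * \<sigma>\<^sup>2 - sqrt (real n) * \<xi>}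
        + emeasure ?N {e \<in> space ?N. m + 2 * (\<Sum>i<n. w i * e i) < 0}"
    by (intro emeasure_subadditive meas)
  also have "\<dots> \<le> ennreal \<beta> + ennreal (exp (- (3 * L * A / (2 * G))))"
  proof (intro add_mono)
    show "emeasure ?N {e \<in> space ?N. m + 2 * (\<Sum>i<n. w i * e i) < 0}
        \<le> ennreal (exp (- (3 * L * A / (2 * G))))"
    proof (rule order_trans)
      show "emeasure ?N {e \<in> space ?N. m + 2 * (\<Sum>i<n. w i * e i) < 0}
          \<le> ennreal (exp (- m\<^sup>2 / (8 * \<sigma>\<^sup>2 * A)))"
        using A0 unfolding noise_def A(1)
        by (intro PiM_gaussian_linear_tail[OF finite_lessThan \<sigma> m0])
    qed (rule ennreal_leI[OF ex])
  qed (simp add: noise_ball_prob[OF \<sigma> xi])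
  finally show ?thesis .
qed

section \<open>Lower tail of the signal energy\<close>

text \<open>The quadratic Taylor polynomials of \<open>exp x\<close> and \<open>exp (- x)\<close> have the product \<open>1 + x^4 / 4 \<ge> 1\<close>.\<close>

lemma exp_neg_le_quadratic:
  fixes x :: real
  assumes "x \<ge> 0"
  shows "exp (- x) \<le> 1 - x + x\<^sup>2 / 2"
proof -
  have "1 + x + x\<^sup>2 / 2 \<le> exp x" by (rule exp_lower_Taylor_quadratic[OF assms])
  moreover have pos: "0 < 1 + x + x\<^sup>2 / 2" using assms by (simp add: add_pos_nonneg)
  ultimately have "exp (- x) \<le> 1 / (1 + x + x\<^sup>2 / 2)"
    by (simp add: exp_minus inverse_eq_divide frac_le)
  also have "\<dots> \<le> 1 - x + x\<^sup>2 / 2"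
  proof -
    have "(1 - x + x\<^sup>2 / 2) * (1 + x + x\<^sup>2 / 2) = 1 + (x\<^sup>2)\<^sup>2 / 4"
      by (simp add: field_simps power2_eq_square)
    then have "1 \<le> (1 - x + x\<^sup>2 / 2) * (1 + x + x\<^sup>2 / 2)" by simp
    then show ?thesis using pos by (simp add: pos_divide_le_eq)
  qed
  finally show ?thesis .
qed

text \<open>
  For lower tails of a nonnegative variable two moments are enough, because \<open>exp (- x)\<close> is bounded by
  its quadratic Taylor polynomial on the whole half-line.
\<close>

lemma nn_integral_exp_neg_square_le:
  fixes w :: "'a \<Rightarrow> real"
  assumes "prob_space P" and "integrable P (\<lambda>x. (w x)\<^sup>2)" and "integrable P (\<lambda>x. (w x) ^ 4)"
    and "(\<integral>x. (w x)\<^sup>2 \<partial>P) = F" and "(\<integral>x. (w x) ^ 4 \<partial>P) \<le> M" and "l \<ge> 0"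
  shows "(\<integral>\<^sup>+ x. ennreal (exp (- l * (w x)\<^sup>2)) \<partial>P) \<le> ennreal (exp (- l * F + l\<^sup>2 * M / 2))"
proof -
  interpret prob_space P by fact
  note int = assms(2,3)
  have pt: "exp (- l * (w x)\<^sup>2) \<le> 1 - l * (w x)\<^sup>2 + l\<^sup>2 / 2 * (w x) ^ 4" for x
  proof -
    have "exp (- (l * (w x)\<^sup>2)) \<le> 1 - l * (w x)\<^sup>2 + (l * (w x)\<^sup>2)\<^sup>2 / 2"
      using assms(6) by (intro exp_neg_le_quadratic) simp
    also have "(l * (w x)\<^sup>2)\<^sup>2 / 2 = l\<^sup>2 / 2 * (w x) ^ 4"
      by (simp add: power_mult_distrib)
    finally show ?thesis by simp
  qed
  have "(\<integral>\<^sup>+ x. ennreal (exp (- l * (w x)\<^sup>2)) \<partial>P)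
      \<le> (\<integral>\<^sup>+ x. ennreal (1 - l * (w x)\<^sup>2 + l\<^sup>2 / 2 * (w x) ^ 4) \<partial>P)"
    by (intro nn_integral_mono ennreal_leI pt)
  also have "\<dots> = ennreal (\<integral>x. 1 - l * (w x)\<^sup>2 + l\<^sup>2 / 2 * (w x) ^ 4 \<partial>P)"
    using int by (intro nn_integral_eq_integral AE_I2 order_trans[OF _ pt]) auto
  also have "(\<integral>x. 1 - l * (w x)\<^sup>2 + l\<^sup>2 / 2 * (w x) ^ 4 \<partial>P)
      = 1 - l * F + l\<^sup>2 / 2 * (\<integral>x. (w x) ^ 4 \<partial>P)"
    using int by (simp add: assms(4) prob_space)
  also have "\<dots> \<le> 1 + (- l * F + l\<^sup>2 * M / 2)"
    using mult_left_mono[OF assms(5), of "l\<^sup>2 / 2"] by simp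
  also have "\<dots> \<le> exp (- l * F + l\<^sup>2 * M / 2)"
    by (rule exp_ge_add_one_self)
  finally show ?thesis by (simp add: ennreal_leI)
qed

lemma nn_integral_PiM_exp_neg_sum_squares:
  fixes w :: "'a \<Rightarrow> real"
  assumes "prob_space D" and [measurable]: "w \<in> borel_measurable D"
  shows "(\<integral>\<^sup>+ X. ennreal (exp (- l * (\<Sum>i<n. (w (X i))\<^sup>2))) \<partial>(\<Pi>\<^sub>M i\<in>{..<n}. D))
    = (\<integral>\<^sup>+ x. ennreal (exp (- l * (w x)\<^sup>2)) \<partial>D) ^ n"
proof -
  interpret product_sigma_finite "\<lambda>_. D"
    using assms(1) by (simp add: product_sigma_finite_def prob_space_imp_sigma_finite)
  have "(\<integral>\<^sup>+ X. ennreal (exp (- l * (\<Sum>i<n. (w (X i))\<^sup>2))) \<partial>(\<Pi>\<^sub>M i\<in>{..<n}. D))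
      = (\<integral>\<^sup>+ X. (\<Prod>i<n. ennreal (exp (- l * (w (X i))\<^sup>2))) \<partial>(\<Pi>\<^sub>M i\<in>{..<n}. D))"
    by (simp add: prod_ennreal exp_sum[symmetric] sum_distrib_left sum_negf)
  also have "\<dots> = (\<Prod>i<n. \<integral>\<^sup>+ x. ennreal (exp (- l * (w x)\<^sup>2)) \<partial>D)"
    by (intro product_nn_integral_prod) auto
  finally show ?thesis by simp
qed

lemma PiM_sum_squares_chernoff:
  fixes w :: "'a \<Rightarrow> real"
  assumes D: "prob_space D" and w[measurable]: "w \<in> borel_measurable D" and l: "l \<ge> 0"
  shows "emeasure (\<Pi>\<^sub>M i\<in>{..<n}. D) {X \<in> space (\<Pi>\<^sub>M i\<in>{..<n}. D). (\<Sum>i<n. (w (X i))\<^sup>2) < y}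
    \<le> ennreal (exp (l * y)) * (\<integral>\<^sup>+ x. ennreal (exp (- l * (w x)\<^sup>2)) \<partial>D) ^ n"
proof -
  let ?Q = "\<Pi>\<^sub>M i\<in>{..<n}. D"
  have "emeasure ?Q {X \<in> space ?Q. (\<Sum>i<n. (w (X i))\<^sup>2) < y}
      = (\<integral>\<^sup>+ X. indicator {X \<in> space ?Q. (\<Sum>i<n. (w (X i))\<^sup>2) < y} X \<partial>?Q)"
    by (rule nn_integral_indicator[symmetric]) measurable
  also have "\<dots> \<le> (\<integral>\<^sup>+ X. ennreal (exp (l * y)) * ennreal (exp (- l * (\<Sum>i<n. (w (X i))\<^sup>2))) \<partial>?Q)"
  proof (rule nn_integral_mono)
    fix X
    have "1 \<le> exp (l * y) * exp (- l * (\<Sum>i<n. (w (X i))\<^sup>2))" if "(\<Sum>i<n. (w (X i))\<^sup>2) < y"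
    proof -
      have "0 \<le> l * (y - (\<Sum>i<n. (w (X i))\<^sup>2))"
        using l that by (intro mult_nonneg_nonneg) auto
      then show ?thesis by (simp add: exp_add[symmetric] algebra_simps)
    qed
    then show "indicator {X \<in> space ?Q. (\<Sum>i<n. (w (X i))\<^sup>2) < y} X
        \<le> ennreal (exp (l * y)) * ennreal (exp (- l * (\<Sum>i<n. (w (X i))\<^sup>2)))"
      by (auto simp: indicator_def ennreal_mult[symmetric])
  qed
  also have "\<dots> = ennreal (exp (l * y)) * (\<integral>\<^sup>+ X. ennreal (exp (- l * (\<Sum>i<n. (w (X i))\<^sup>2))) \<partial>?Q)"
    by (rule nn_integral_cmult) measurable
  also have "\<dots> = ennreal (exp (l * y)) * (\<integral>\<^sup>+ x. ennreal (exp (- l * (w x)\<^sup>2)) \<partial>D) ^ n"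
    by (simp only: nn_integral_PiM_exp_neg_sum_squares[OF D w])
  finally show ?thesis .
qed

text \<open>
  Chernoff's bound, optimised at \<open>l = (n F - y) / (n M)\<close>. Only the bound on the Laplace transform enters,
  so that \<open>M\<close> may be any upper bound of the fourth moment.
\<close>

lemma PiM_sum_squares_lower_tail:
  fixes w :: "'a \<Rightarrow> real"
  assumes D: "prob_space D" and w: "w \<in> borel_measurable D" and n: "n \<ge> 1" and M: "M > 0"
    and mgf: "\<And>l. l \<ge> 0 \<Longrightarrow> (\<integral>\<^sup>+ x. ennreal (exp (- l * (w x)\<^sup>2)) \<partial>D) \<le> ennreal (exp (- l * F + l\<^sup>2 * M / 2))"
    and y: "y \<le> real n * F"
  shows "emeasure (\<Pi>\<^sub>M i\<in>{..<n}. D) {X \<in> space (\<Pi>\<^sub>M i\<in>{..<n}. D). (\<Sum>i<n. (w (X i))\<^sup>2) < y}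
    \<le> ennreal (exp (- (real n * F - y)\<^sup>2 / (2 * real n * M)))"
proof -
  define l where "l = (real n * F - y) / (real n * M)"
  have l: "l \<ge> 0" using y n M by (simp add: l_def)
  have "emeasure (\<Pi>\<^sub>M i\<in>{..<n}. D) {X \<in> space (\<Pi>\<^sub>M i\<in>{..<n}. D). (\<Sum>i<n. (w (X i))\<^sup>2) < y}
      \<le> ennreal (exp (l * y)) * (\<integral>\<^sup>+ x. ennreal (exp (- l * (w x)\<^sup>2)) \<partial>D) ^ n"
    by (rule PiM_sum_squares_chernoff[OF D w l])
  also have "\<dots> \<le> ennreal (exp (l * y)) * ennreal (exp (- l * F + l\<^sup>2 * M / 2)) ^ n"
    by (intro mult_left_mono power_mono mgf l) auto
  also have "\<dots> = ennreal (exp (l * y + real n * (- l * F + l\<^sup>2 * M / 2)))"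
    by (simp add: ennreal_power ennreal_mult[symmetric] exp_of_nat_mult[symmetric] mult_exp_exp)
  also have "l * y + real n * (- l * F + l\<^sup>2 * M / 2) = - (real n * F - y)\<^sup>2 / (2 * real n * M)"
  proof -
    define u where "u = real n * F - y"
    have "l * y + real n * (- l * F + l\<^sup>2 * M / 2) = - l * u + real n * l\<^sup>2 * M / 2"
      by (simp add: u_def algebra_simps)
    also have "\<dots> = - u\<^sup>2 / (2 * real n * M)"
      using n M unfolding l_def u_def[symmetric] by (simp add: field_simps power2_eq_square)
    finally show ?thesis by (simp add: u_def)
  qed
  finally show ?thesis .
qed

section \<open>From conditional non-coverage to coverage\<close>

lemma space_mat_space[simp]: "space (mat_space d) = carrier_mat d d"
  by (simp add: mat_space_def)

lemma measurable_mat_entry: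
  assumes "p \<in> {..<d} \<times> {..<d}"
  shows "(\<lambda>A. A $$ p) \<in> borel_measurable (mat_space d)"
proof -
  have "(\<lambda>A. \<lambda>p\<in>{..<d} \<times> {..<d}. A $$ p) \<in> mat_space d \<rightarrow>\<^sub>M (\<Pi>\<^sub>M p\<in>{..<d} \<times> {..<d}. borel :: complex measure)"
    unfolding mat_space_def by (rule measurable_vimage_algebra1) (auto simp: space_PiM)
  from measurable_compose[OF this measurable_component_singleton[OF assms]]
  show ?thesis using assms by simp
qed

lemma mtrace_times:
  assumes "A \<in> carrier_mat d d" "B \<in> carrier_mat d d"
  shows "mtrace (A * B) = (\<Sum>i<d. \<Sum>k<d. A $$ (i, k) * B $$ (k, i))"
  using assms unfolding mtrace_def
  by (auto intro!: sum.cong simp: scalar_prod_def atLeast0LessThan)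

lemma mtrace_times_minus:
  fixes X :: "complex mat"
  assumes "X \<in> carrier_mat d d" "A \<in> carrier_mat d d" "B \<in> carrier_mat d d"
  shows "mtrace (X * (A - B)) = mtrace (X * A) - mtrace (X * B)"
  unfolding mtrace_times[OF assms(1,2)] mtrace_times[OF assms(1,3)]
    mtrace_times[OF assms(1) minus_carrier_mat[OF assms(3)]]
  using assms by (simp add: right_diff_distrib sum_subtractf)

lemma measurable_mtrace_times:
  fixes B :: "complex mat"
  assumes "sets D = sets (mat_space d)" "B \<in> carrier_mat d d"
  shows "(\<lambda>A. mtrace (A * B)) \<in> borel_measurable D"
proof -
  have "(\<lambda>A. \<Sum>i<d. \<Sum>k<d. A $$ (i, k) * B $$ (k, i)) \<in> borel_measurable (mat_space d)"
    by (intro borel_measurable_sum borel_measurable_times borel_measurable_const measurable_mat_entry) auto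
  then have "(\<lambda>A. mtrace (A * B)) \<in> borel_measurable (mat_space d)"
    by (rule measurable_cong[THEN iffD1, rotated]) (use assms in \<open>simp add: mtrace_times\<close>)
  then show ?thesis
    using measurable_cong_sets[OF assms(1) refl] by blast
qed

lemma hermitian_carrier: "A \<in> hermitian_mats d \<Longrightarrow> A \<in> carrier_mat d d"
  by (simp add: hermitian_mats_def)

text \<open>
  The reduction of coverage to the noise alone. Dropping the imaginary parts of the measurements
  decreases the residual sum of squares, so that a miss forces the shifted noise energy below \<open>thr\<close>;
  Fubini's theorem then allows this to be bounded separately for every design \<open>X\<close>.
\<close>

lemma coverage_ge:
  fixes D :: "complex mat measure"
  assumes n: "n \<ge> 1" and \<sigma>: "\<sigma> > 0" and D: "prob_space D" and sD: "sets D = sets (mat_space d)"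
    and \<theta>: "\<theta> \<in> hermitian_mats d" and \<theta>t: "\<theta>t \<in> hermitian_mats d"
    and thr: "thr = real n * \<sigma>\<^sup>2 - sqrt (real n) * \<xi>
      + (real n * (frob_norm (\<theta> - \<theta>t))\<^sup>2 - 2 * (z * real d)) / 2 - sqrt (real n) * zbar n d \<sigma> \<alpha> z \<theta>t \<theta>"
    and g: "\<And>X. X \<in> space (\<Pi>\<^sub>M i\<in>{..<n}. D) \<Longrightarrow>
      emeasure (noise n \<sigma>) {e \<in> space (noise n \<sigma>).
        (\<Sum>i<n. (Re (mtrace (X i * (\<theta> - \<theta>t))) + e i)\<^sup>2) < thr} \<le> g X"
    and p: "(\<integral>\<^sup>+ X. g X \<partial>(\<Pi>\<^sub>M i\<in>{..<n}. D)) \<le> ennreal p" "p \<ge> 0"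
  shows "coverage n d D \<sigma> \<alpha> \<xi> z \<theta>t \<theta> \<ge> 1 - p"
proof -
  let ?N = "noise n \<sigma>" and ?Q = "\<Pi>\<^sub>M i\<in>{..<n}. D"
  let ?R = "(\<Pi>\<^sub>M i\<in>{..<n}. borel :: complex measure) \<Otimes>\<^sub>M ?Q"
  let ?T = "\<lambda>(e, X). (\<lambda>i\<in>{..<n}. sampling X \<theta> i + complex_of_real (e i), X)"
  define S where "S = {\<omega> \<in> space ?R. \<theta> \<in> conf_set n d \<sigma> \<alpha> \<xi> z \<theta>t \<omega>}"
  interpret N: prob_space ?N by (rule prob_space_noise[OF \<sigma>])
  interpret Q: prob_space ?Q by (rule prob_space_PiM) (rule D)
  interpret NQ: pair_prob_space ?N ?Q ..
  have c: "\<theta> \<in> carrier_mat d d" "\<theta>t \<in> carrier_mat d d" "\<theta> - \<theta>t \<in> carrier_mat d d"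
    using \<theta> \<theta>t by (auto simp: hermitian_mats_def)
  have samp[measurable]: "(\<lambda>X. sampling X B i) \<in> borel_measurable ?Q"
    if "i \<in> {..<n}" "B \<in> carrier_mat d d" for i B
    unfolding sampling_def
    by (rule measurable_compose[OF measurable_component_singleton[OF that(1)] measurable_mtrace_times[OF sD that(2)]])
  have e_meas: "(\<lambda>e. e i) \<in> borel_measurable ?N" if "i \<in> {..<n}" for i
    using measurable_component_singleton[OF that, of "\<lambda>_. gaussian \<sigma>"]
    unfolding noise_def by (simp add: measurable_cong_sets[OF refl sets_gaussian])
  have T: "?T \<in> (?N \<Otimes>\<^sub>M ?Q) \<rightarrow>\<^sub>M ?R"
  proof (subst case_prod_beta', rule measurable_Pair[OF measurable_restrict measurable_snd])
    fix i assume i: "i \<in> {..<n}"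
    show "(\<lambda>x. sampling (snd x) \<theta> i + complex_of_real (fst x i)) \<in> borel_measurable (?N \<Otimes>\<^sub>M ?Q)"
      using measurable_compose[OF measurable_snd samp[OF i c(1)], of ?N]
        measurable_compose[OF measurable_fst e_meas[OF i], of ?Q]
      by (intro borel_measurable_add borel_measurable_of_real) auto
  qed
  have rssm: "(\<lambda>\<omega>. rss n (fst \<omega>) (snd \<omega>) \<sigma> \<theta>t) \<in> borel_measurable ?R"
  proof -
    have "(\<lambda>\<omega>. cmod (fst \<omega> i - sampling (snd \<omega>) \<theta>t i)) \<in> borel_measurable ?R" if i: "i \<in> {..<n}" for i
      using measurable_compose[OF measurable_snd samp[OF i c(2)], of "\<Pi>\<^sub>M i\<in>{..<n}. borel :: complex measure"]
        measurable_compose[OF measurable_fst measurable_component_singleton[OF i], of "\<lambda>_. borel :: complex measure" ?Q]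
      by (intro borel_measurable_norm[THEN measurable_compose[rotated]] borel_measurable_diff) auto
    then show ?thesis unfolding rss_def
      by (intro borel_measurable_diff borel_measurable_times borel_measurable_sum
          borel_measurable_power borel_measurable_const) auto
  qed
  have S: "S \<in> sets ?R"
    unfolding S_def conf_set_def using \<theta> rssm by (simp add: case_prod_beta)
  define B where "B = {\<omega> \<in> space (?N \<Otimes>\<^sub>M ?Q).
      (\<Sum>i<n. (Re (sampling (snd \<omega>) (\<theta> - \<theta>t) i) + fst \<omega> i)\<^sup>2) < thr}"
  have Bm: "B \<in> sets (?N \<Otimes>\<^sub>M ?Q)"
  proof -
    have "(\<lambda>\<omega>. Re (sampling (snd \<omega>) (\<theta> - \<theta>t) i) + fst \<omega> i) \<in> borel_measurable (?N \<Otimes>\<^sub>M ?Q)"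
      if i: "i \<in> {..<n}" for i
      using measurable_compose[OF measurable_snd samp[OF i c(3)], of ?N]
        measurable_compose[OF measurable_fst e_meas[OF i], of ?Q]
      by (intro borel_measurable_add borel_measurable_Re[THEN measurable_compose[rotated]]) auto
    then have "(\<lambda>\<omega>. \<Sum>i<n. (Re (sampling (snd \<omega>) (\<theta> - \<theta>t) i) + fst \<omega> i)\<^sup>2) \<in> borel_measurable (?N \<Otimes>\<^sub>M ?Q)"
      by (intro borel_measurable_sum borel_measurable_power) auto
    then show ?thesis unfolding B_def by simp
  qed
  have miss: "\<omega> \<in> B" if \<omega>: "\<omega> \<in> space (?N \<Otimes>\<^sub>M ?Q)" "?T \<omega> \<notin> S" for \<omega>
  proof -
    obtain e X where eX: "\<omega> = (e, X)" by (cases \<omega>)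
    have Xc: "X i \<in> carrier_mat d d" if "i < n" for i
    proof -
      have "X \<in> space ?Q" using \<omega> by (simp add: eX space_pair_measure)
      then have "X i \<in> space D" using that by (auto simp: space_PiM)
      then show ?thesis using sets_eq_imp_space_eq[OF sD] by simp
    qed
    let ?Y = "\<lambda>i\<in>{..<n}. sampling X \<theta> i + complex_of_real (e i)"
    have "?T \<omega> \<in> space ?R" by (rule measurable_space[OF T \<omega>(1)])
    then have fail: "\<not> (frob_norm (\<theta> - \<theta>t))\<^sup>2 \<le> 2 * (rss n ?Y X \<sigma> \<theta>t + z * real d / real n
        + (zbar n d \<sigma> \<alpha> z \<theta>t \<theta> + \<xi>) / sqrt (real n))"
      using \<omega>(2) \<theta> by (simp add: S_def conf_set_def eX)
    define s where "s = (\<Sum>i<n. (cmod (?Y i - sampling X \<theta>t i))\<^sup>2)"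
    have "(\<Sum>i<n. (Re (sampling X (\<theta> - \<theta>t) i) + e i)\<^sup>2) \<le> s"
      unfolding s_def
    proof (rule sum_mono)
      fix i assume i: "i \<in> {..<n}"
      have "?Y i - sampling X \<theta>t i = sampling X (\<theta> - \<theta>t) i + complex_of_real (e i)"
        using i mtrace_times_minus[OF Xc[of i] c(1,2)] by (simp add: sampling_def)
      then show "(Re (sampling X (\<theta> - \<theta>t) i) + e i)\<^sup>2 \<le> (cmod (?Y i - sampling X \<theta>t i))\<^sup>2"
        by (simp add: cmod_power2)
    qed
    also have "s < thr"
    proof -
      define q where "q = sqrt (real n)"
      have q: "q > 0" "real n = q * q" using n by (auto simp: q_def)
      have "s / (q * q) - \<sigma>\<^sup>2 + z * real d / (q * q) + (zbar n d \<sigma> \<alpha> z \<theta>t \<theta> + \<xi>) / q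
          < (frob_norm (\<theta> - \<theta>t))\<^sup>2 / 2"
        using fail unfolding rss_def s_def[symmetric] q_def[symmetric] q(2) using q(1) by (simp add: algebra_simps)
      then have *: "(s / (q * q) - \<sigma>\<^sup>2 + z * real d / (q * q) + (zbar n d \<sigma> \<alpha> z \<theta>t \<theta> + \<xi>) / q) * (q * q)
          < (frob_norm (\<theta> - \<theta>t))\<^sup>2 / 2 * (q * q)"
        using q by (intro mult_strict_right_mono) auto
      show ?thesis
      proof -
        have eq: "(s / (q * q) - \<sigma>\<^sup>2 + z * real d / (q * q) + (zbar n d \<sigma> \<alpha> z \<theta>t \<theta> + \<xi>) / q) * (q * q)
            = s - \<sigma>\<^sup>2 * (q * q) + z * real d + (zbar n d \<sigma> \<alpha> z \<theta>t \<theta> + \<xi>) * q"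
          using q(1) by (simp add: field_simps)
        show ?thesis
          using *[unfolded eq] q(1) unfolding thr q(2) by (simp add: field_simps)
      qed
    qed
    finally show ?thesis using \<omega> by (simp add: B_def eX)
  qed
  have "emeasure (?N \<Otimes>\<^sub>M ?Q) B = (\<integral>\<^sup>+ X. emeasure ?N ((\<lambda>e. (e, X)) -` B) \<partial>?Q)"
    by (rule NQ.emeasure_pair_measure_alt2[OF Bm])
  also have "\<dots> \<le> (\<integral>\<^sup>+ X. g X \<partial>?Q)"
  proof (rule nn_integral_mono)
    fix X assume X: "X \<in> space ?Q"
    have "(\<lambda>e. (e, X)) -` B = {e \<in> space ?N.
        (\<Sum>i<n. (Re (mtrace (X i * (\<theta> - \<theta>t))) + e i)\<^sup>2) < thr}"
      using X by (auto simp: B_def space_pair_measure sampling_def)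
    then show "emeasure ?N ((\<lambda>e. (e, X)) -` B) \<le> g X" using g[OF X] by simp
  qed
  also note p(1)
  finally have Bp: "NQ.prob B \<le> p"
    using p(2) by (simp add: NQ.emeasure_eq_measure)
  have "coverage n d D \<sigma> \<alpha> \<xi> z \<theta>t \<theta> = NQ.prob (?T -` S \<inter> space (?N \<Otimes>\<^sub>M ?Q))"
    unfolding coverage_def model_law_def space_distr S_def[symmetric]
    by (rule measure_distr[OF T S])
  moreover have "NQ.prob (space (?N \<Otimes>\<^sub>M ?Q) - B) \<le> NQ.prob (?T -` S \<inter> space (?N \<Otimes>\<^sub>M ?Q))"
  proof (rule NQ.finite_measure_mono[OF _ measurable_sets[OF T S]])
    show "space (?N \<Otimes>\<^sub>M ?Q) - B \<subseteq> ?T -` S \<inter> space (?N \<Otimes>\<^sub>M ?Q)"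
      using miss by blast
  qed
  moreover have "NQ.prob (space (?N \<Otimes>\<^sub>M ?Q) - B) = 1 - NQ.prob B"
    by (rule NQ.prob_compl[OF Bm])
  ultimately show ?thesis using Bp by linarith
qed

section \<open>Coverage from the Laplace transform of one squared measurement\<close>

lemma exp_neg_z_const:
  assumes "\<alpha> > 0"
  shows "exp (- z_const (\<alpha> / 3)) = \<alpha> / 9"
  using assms by (simp add: z_const_def exp_minus)

lemma z_const_nonneg: "0 < \<alpha> \<Longrightarrow> \<alpha> < 1 \<Longrightarrow> z_const (\<alpha> / 3) \<ge> 0"
  by (simp add: z_const_def)

text \<open>
  With \<open>b = 2 z d\<close> this is the form in which the width of the confidence set enters the strong-signal
  regime; it rests on \<open>zbar\<^sup>2 \<ge> 3 L \<sigma>\<^sup>2 F\<close>.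
\<close>

lemma zbar_ge:
  assumes "0 < \<alpha>" "\<alpha> < 1" "\<sigma> > 0" "b \<ge> 0"
    and F: "F = (frob_norm (\<theta> - \<theta>t))\<^sup>2"
  shows "sqrt (real n) * zbar n d \<sigma> \<alpha> z \<theta>t \<theta>
    \<ge> \<sigma> * sqrt (3 * z_const (\<alpha> / 3) * (real n * F - b))"
    and "zbar n d \<sigma> \<alpha> z \<theta>t \<theta> \<ge> 0"
proof -
  define L where "L = z_const (\<alpha> / 3)"
  define m where "m = max (3 * F) (4 * z * real d / real n)"
  have L: "L \<ge> 0" using z_const_nonneg assms(1,2) by (simp add: L_def)
  have "F \<ge> 0" by (simp add: F)
  then have m0: "m \<ge> 0" "m \<ge> 3 * F" by (auto simp: m_def)
  have zb: "zbar n d \<sigma> \<alpha> z \<theta>t \<theta> = sqrt (L * \<sigma>\<^sup>2 * m)"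
    by (simp add: zbar_def L_def m_def F)
  then show "zbar n d \<sigma> \<alpha> z \<theta>t \<theta> \<ge> 0" using L m0 by simp
  have "real n * m \<ge> real n * (3 * F)" using m0 by (intro mult_left_mono) auto
  then have "3 * L * (real n * F - b) \<le> L * (real n * m)"
    using mult_left_mono[of "3 * (real n * F - b)" "real n * m" L] L assms(4) by (simp add: algebra_simps)
  then have "\<sigma> * sqrt (3 * L * (real n * F - b)) \<le> \<sigma> * sqrt (L * (real n * m))"
    using assms(3) by (intro mult_left_mono) auto
  also have "\<dots> = sqrt (real n) * sqrt (L * \<sigma>\<^sup>2 * m)"
    using assms(3) by (simp add: real_sqrt_mult)
  finally show "sqrt (real n) * zbar n d \<sigma> \<alpha> z \<theta>t \<theta>
    \<ge> \<sigma> * sqrt (3 * z_const (\<alpha> / 3) * (real n * F - b))"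
    by (simp add: zb L_def)
qed

lemma coverage_small_signal:
  fixes D :: "complex mat measure"
  assumes n: "n \<ge> 1" and \<sigma>: "\<sigma> > 0" and D: "prob_space D" and sD: "sets D = sets (mat_space d)"
    and \<theta>: "\<theta> \<in> hermitian_mats d" and \<theta>t: "\<theta>t \<in> hermitian_mats d"
    and \<alpha>: "0 < \<alpha>" and xi: "is_xi n \<sigma> (\<alpha> / 3) \<xi>"
    and small: "(real n * (frob_norm (\<theta> - \<theta>t))\<^sup>2 - 2 * (z * real d)) / 2 \<le> sqrt (real n) * zbar n d \<sigma> \<alpha> z \<theta>t \<theta>"
  shows "coverage n d D \<sigma> \<alpha> \<xi> z \<theta>t \<theta> \<ge> 1 - \<alpha> / 3"
proof (rule coverage_ge[OF n \<sigma> D sD \<theta> \<theta>t refl])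
  interpret Q: prob_space "\<Pi>\<^sub>M i\<in>{..<n}. D" by (rule prob_space_PiM) (rule D)
  show "(\<integral>\<^sup>+ X. ennreal (\<alpha> / 3) \<partial>(\<Pi>\<^sub>M i\<in>{..<n}. D)) \<le> ennreal (\<alpha> / 3)"
    by (simp add: Q.emeasure_space_1)
qed (use noncoverage_small_signal[OF \<sigma> xi small] \<alpha> in auto)

text \<open>
  In the strong-signal regime designs with \<open>A < 2 G / 3\<close> are given up: they have probability at most
  the exponential term, and for all others the cross term costs at most \<open>exp (- L) = \<alpha> / 9\<close>. The
  deviation of \<open>A\<close> from its mean is \<open>n F - 2 G / 3 = (n F + 4 z d) / 3\<close>.
\<close>

lemma coverage_ge_of_energy_mgf:
  fixes D :: "complex mat measure" and d :: nat and z :: real and \<theta> \<theta>t :: "complex mat"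
  assumes n: "n \<ge> 1" and \<sigma>: "\<sigma> > 0" and D: "prob_space D" and sD: "sets D = sets (mat_space d)"
    and \<theta>: "\<theta> \<in> hermitian_mats d" and \<theta>t: "\<theta>t \<in> hermitian_mats d"
    and \<alpha>: "0 < \<alpha>" "\<alpha> < 1" and xi: "is_xi n \<sigma> (\<alpha> / 3) \<xi>" and z: "z \<ge> 0"
    and F: "F = (frob_norm (\<theta> - \<theta>t))\<^sup>2" and M: "F > 0 \<Longrightarrow> M > 0"
    and mgf: "\<And>l. l \<ge> 0 \<Longrightarrow> (\<integral>\<^sup>+ X. ennreal (exp (- l * (Re (mtrace (X * (\<theta> - \<theta>t))))\<^sup>2)) \<partial>D)
      \<le> ennreal (exp (- l * F + l\<^sup>2 * M / 2))"
  shows "coverage n d D \<sigma> \<alpha> \<xi> z \<theta>t \<theta>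
    \<ge> 1 - (2 * \<alpha> / 3 + exp (- ((real n * F + 4 * z * real d) / 3)\<^sup>2 / (2 * real n * M)))"
proof -
  define G where "G = real n * F - 2 * (z * real d)"
  define E where "E = exp (- ((real n * F + 4 * z * real d) / 3)\<^sup>2 / (2 * real n * M))"
  define Dv where "Dv = sqrt (real n) * zbar n d \<sigma> \<alpha> z \<theta>t \<theta>"
  define L where "L = z_const (\<alpha> / 3)"
  have F0: "F \<ge> 0" by (simp add: F)
  have L: "L \<ge> 0" using z_const_nonneg \<alpha> by (simp add: L_def)
  have Dv: "Dv \<ge> \<sigma> * sqrt (3 * L * G)" "Dv \<ge> 0"
    using zbar_ge[OF \<alpha> \<sigma> _ F, of "2 * (z * real d)" n d z] z by (auto simp: Dv_def L_def G_def)
  have "E > 0" by (simp add: E_def)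
  show ?thesis
  proof (cases "G / 2 \<le> Dv")
    case True
    then have "coverage n d D \<sigma> \<alpha> \<xi> z \<theta>t \<theta> \<ge> 1 - \<alpha> / 3"
      using coverage_small_signal[OF n \<sigma> D sD \<theta> \<theta>t \<alpha>(1) xi] by (simp add: G_def Dv_def F)
    then show ?thesis using \<open>E > 0\<close> \<alpha> unfolding E_def[symmetric] by linarith
  next
    case False
    then have G: "G > 0" using Dv(2) by linarith
    have "real n * F > 0" using G mult_nonneg_nonneg[OF z, of "real d"] by (simp add: G_def)
    then have "F > 0" using F0 by (cases "F = 0") auto
    then have M0: "M > 0" by (rule M)
    have c: "\<theta> - \<theta>t \<in> carrier_mat d d"
      using hermitian_carrier[OF \<theta>t] by (rule minus_carrier_mat)
    define w where "w X = Re (mtrace (X * (\<theta> - \<theta>t)))" for X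
    have w[measurable]: "w \<in> borel_measurable D"
      using borel_measurable_Re[THEN measurable_compose[rotated], OF measurable_mtrace_times[OF sD c]]
      unfolding w_def[abs_def] .
    let ?Q = "\<Pi>\<^sub>M i\<in>{..<n}. D"
    interpret Q: prob_space ?Q by (rule prob_space_PiM) (rule D)
    interpret N: prob_space "noise n \<sigma>" by (rule prob_space_noise[OF \<sigma>])
    define bad where "bad = {X \<in> space ?Q. (\<Sum>i<n. (w (X i))\<^sup>2) < 2 * G / 3}"
    have badm[measurable]: "bad \<in> sets ?Q" unfolding bad_def by measurable
    have bad: "emeasure ?Q bad \<le> ennreal E"
    proof -
      have "emeasure ?Q bad \<le> ennreal (exp (- (real n * F - 2 * G / 3)\<^sup>2 / (2 * real n * M)))"
        unfolding bad_def
      proof (rule PiM_sum_squares_lower_tail[OF D w n M0])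
        have "G \<le> real n * F" using z by (simp add: G_def)
        then show "2 * G / 3 \<le> real n * F" using G by linarith
      qed (use mgf in \<open>simp add: w_def\<close>)
      also have "real n * F - 2 * G / 3 = (real n * F + 4 * z * real d) / 3"
        by (simp add: G_def field_simps)
      finally show ?thesis by (simp add: E_def)
    qed
    show ?thesis unfolding E_def[symmetric]
    proof (rule coverage_ge[OF n \<sigma> D sD \<theta> \<theta>t refl])
      fix X assume X: "X \<in> space ?Q"
      let ?fail = "{e \<in> space (noise n \<sigma>). (\<Sum>i<n. (Re (mtrace (X i * (\<theta> - \<theta>t))) + e i)\<^sup>2)
        < real n * \<sigma>\<^sup>2 - sqrt (real n) * \<xi> + (real n * (frob_norm (\<theta> - \<theta>t))\<^sup>2 - 2 * (z * real d)) / 2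
          - sqrt (real n) * zbar n d \<sigma> \<alpha> z \<theta>t \<theta>}"
      show "emeasure (noise n \<sigma>) ?fail \<le> ennreal (2 * \<alpha> / 3) + indicator bad X"
      proof (cases "X \<in> bad")
        case True
        then show ?thesis using N.emeasure_le_1[of ?fail] by (simp add: add_increasing)
      next
        case False
        define A where "A = (\<Sum>i<n. (w (X i))\<^sup>2)"
        have A: "A \<ge> 2 * G / 3" using False X by (simp add: bad_def A_def)
        have "emeasure (noise n \<sigma>) ?fail \<le> ennreal (\<alpha> / 3) + ennreal (exp (- (3 * L * A / (2 * G))))"
          using noncoverage_large_signal[OF \<sigma> xi L _ Dv, of A "\<lambda>i. w (X i)"] \<open>\<not> G / 2 \<le> Dv\<close> A G
          by (simp add: A_def w_def G_def Dv_def F)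
        also have "\<dots> \<le> ennreal (2 * \<alpha> / 3)"
        proof -
          have "3 * L * A / (2 * G) \<ge> L"
            using mult_left_mono[OF A L] G by (simp add: field_simps)
          then have "exp (- (3 * L * A / (2 * G))) \<le> \<alpha> / 9"
            using exp_neg_z_const[OF \<alpha>(1)] by (metis L_def exp_le_cancel_iff neg_le_iff_le)
          then show ?thesis using \<alpha> by (simp add: ennreal_plus[symmetric] ennreal_leI del: ennreal_plus)
        qed
        finally show ?thesis using False by simp
      qed
    next
      have "(\<integral>\<^sup>+ X. ennreal (2 * \<alpha> / 3) + indicator bad X \<partial>?Q) = ennreal (2 * \<alpha> / 3) + emeasure ?Q bad"
        by (subst nn_integral_add) (auto simp: Q.emeasure_space_1)
      also have "\<dots> \<le> ennreal (2 * \<alpha> / 3) + ennreal E" by (intro add_left_mono bad)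
      finally show "(\<integral>\<^sup>+ X. ennreal (2 * \<alpha> / 3) + indicator bad X \<partial>?Q) \<le> ennreal (2 * \<alpha> / 3 + E)"
        using \<alpha> \<open>E > 0\<close> by simp
    qed (use \<alpha> \<open>E > 0\<close> in simp)
  qed
qed

text \<open>
  The constant \<open>1 / 24\<close> is too large for discarding all designs with \<open>A < 2 G / 3\<close>. Only those with
  \<open>A < G / 2\<close> are discarded, at the cost \<open>exp (n / 4) * 2 powr (- n / 2)\<close>, and \<open>exp (- 3 L A / (2 G))\<close> is
  averaged over the design, which gives \<open>(1 + 3 L / n) powr (- n / 2)\<close>. If \<open>L \<le> n / 4\<close>, this is at most
  \<open>exp (- L) = \<alpha> / 9\<close>; otherwise it is at most \<open>exp (- n / 24)\<close>. This is where the second exponential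
  in the coverage bound comes from.
\<close>

lemma coverage_ge_of_gaussian_mgf:
  fixes D :: "complex mat measure" and d :: nat and \<theta> \<theta>t :: "complex mat"
  assumes n: "n \<ge> 1" and \<sigma>: "\<sigma> > 0" and D: "prob_space D" and sD: "sets D = sets (mat_space d)"
    and \<theta>: "\<theta> \<in> hermitian_mats d" and \<theta>t: "\<theta>t \<in> hermitian_mats d"
    and \<alpha>: "0 < \<alpha>" "\<alpha> < 1" and xi: "is_xi n \<sigma> (\<alpha> / 3) \<xi>"
    and F: "F = (frob_norm (\<theta> - \<theta>t))\<^sup>2"
    and mgf: "\<And>l. l \<ge> 0 \<Longrightarrow> (\<integral>\<^sup>+ X. ennreal (exp (- l * (Re (mtrace (X * (\<theta> - \<theta>t))))\<^sup>2)) \<partial>D)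
      = ennreal (1 / sqrt (1 + 2 * l * F))"
  shows "coverage n d D \<sigma> \<alpha> \<xi> 0 \<theta>t \<theta> \<ge> 1 - (2 * \<alpha> / 3 + 2 * exp (- (1 / 24) * real n))"
proof -
  define G where "G = real n * F"
  define E where "E = exp (- (1 / 24) * real n)"
  define Dv where "Dv = sqrt (real n) * zbar n d \<sigma> \<alpha> 0 \<theta>t \<theta>"
  define L where "L = z_const (\<alpha> / 3)"
  have L: "L \<ge> 0" using z_const_nonneg \<alpha> by (simp add: L_def)
  have Dv: "Dv \<ge> \<sigma> * sqrt (3 * L * G)" "Dv \<ge> 0"
    using zbar_ge[OF \<alpha> \<sigma> _ F, of 0 n d 0] by (auto simp: Dv_def L_def G_def)
  have E0: "E > 0" by (simp add: E_def)
  show ?thesis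
  proof (cases "G / 2 \<le> Dv")
    case True
    then have "coverage n d D \<sigma> \<alpha> \<xi> 0 \<theta>t \<theta> \<ge> 1 - \<alpha> / 3"
      using coverage_small_signal[OF n \<sigma> D sD \<theta> \<theta>t \<alpha>(1) xi] by (simp add: G_def Dv_def F)
    then show ?thesis using E0 \<alpha> unfolding E_def[symmetric] by linarith
  next
    case False
    then have G: "G > 0" using Dv(2) by linarith
    then have F0: "F > 0" by (simp add: G_def zero_less_mult_iff)
    have c: "\<theta> - \<theta>t \<in> carrier_mat d d"
      using hermitian_carrier[OF \<theta>t] by (rule minus_carrier_mat)
    define w where "w X = Re (mtrace (X * (\<theta> - \<theta>t)))" for X
    have w[measurable]: "w \<in> borel_measurable D"
      using borel_measurable_Re[THEN measurable_compose[rotated], OF measurable_mtrace_times[OF sD c]]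
      unfolding w_def[abs_def] .
    let ?Q = "\<Pi>\<^sub>M i\<in>{..<n}. D"
    interpret Q: prob_space ?Q by (rule prob_space_PiM) (rule D)
    interpret N: prob_space "noise n \<sigma>" by (rule prob_space_noise[OF \<sigma>])
    have mgfw: "(\<integral>\<^sup>+ x. ennreal (exp (- l * (w x)\<^sup>2)) \<partial>D) ^ n = ennreal ((1 + 2 * l * F) powr (- real n / 2))"
      if "l \<ge> 0" for l
    proof -
      have pos: "1 + 2 * l * F > 0" using that F0 by (simp add: add_pos_nonneg)
      have "(1 / sqrt (1 + 2 * l * F)) ^ n = ((1 + 2 * l * F) powr (- 1 / 2)) ^ n"
        using pos by (simp add: powr_minus_divide powr_half_sqrt)
      also have "\<dots> = (1 + 2 * l * F) powr (- real n / 2)"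
        using pos by (simp add: powr_realpow[symmetric] powr_powr)
      finally show ?thesis
        using mgf[OF that] pos by (simp add: w_def ennreal_power)
    qed
    define bad where "bad = {X \<in> space ?Q. (\<Sum>i<n. (w (X i))\<^sup>2) < G / 2}"
    have badm[measurable]: "bad \<in> sets ?Q" unfolding bad_def by measurable
    have bad: "emeasure ?Q bad \<le> ennreal E"
    proof -
      \<comment> \<open>The best exponent for the threshold \<open>G / 2\<close>.\<close>
      define l where "l = 1 / (2 * F)"
      have l: "l \<ge> 0" "1 + 2 * l * F = 2" "l * (G / 2) = real n / 4"
        unfolding l_def G_def using F0 by (simp_all add: field_simps)
      have "emeasure ?Q bad \<le> ennreal (exp (l * (G / 2))) * (\<integral>\<^sup>+ x. ennreal (exp (- l * (w x)\<^sup>2)) \<partial>D) ^ n"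
        unfolding bad_def by (rule PiM_sum_squares_chernoff[OF D w l(1)])
      also have "\<dots> = ennreal (exp (real n / 4) * 2 powr (- real n / 2))"
        unfolding mgfw[OF l(1)] l(2,3) by (simp add: ennreal_mult[symmetric])
      also have "exp (real n / 4) * 2 powr (- real n / 2) = exp (real n * (1 / 4 - ln 2 / 2))"
        by (simp add: powr_def exp_add[symmetric] algebra_simps)
      also have "\<dots> \<le> E"
      proof -
        have "ln 2 \<ge> (2 / 3 :: real)" by (rule ln2_ge_two_thirds)
        then have "real n * (1 / 4 - ln 2 / 2) \<le> real n * (- (1 / 24))"
          by (intro mult_left_mono) auto
        then show ?thesis by (simp add: E_def)
      qed
      finally show ?thesis by (simp add: ennreal_leI)
    qed
    have tail: "(\<integral>\<^sup>+ X. ennreal (exp (- (3 * L / (2 * G)) * (\<Sum>i<n. (w (X i))\<^sup>2))) \<partial>?Q) \<le> ennreal (\<alpha> / 9 + E)"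
    proof -
      define x where "x = L / real n"
      have x: "x \<ge> 0" "L = real n * x" using L n by (auto simp: x_def)
      have l0: "3 * L / (2 * G) \<ge> 0" using L G by simp
      have "1 + 2 * (3 * L / (2 * G)) * F = 1 + 3 * x"
        using G F0 n by (simp add: x_def G_def)
      then have "(\<integral>\<^sup>+ X. ennreal (exp (- (3 * L / (2 * G)) * (\<Sum>i<n. (w (X i))\<^sup>2))) \<partial>?Q)
          = ennreal ((1 + 3 * x) powr (- real n / 2))"
        unfolding nn_integral_PiM_exp_neg_sum_squares[OF D w] mgfw[OF l0] by simp
      also have "(1 + 3 * x) powr (- real n / 2) = exp (- (real n / 2 * ln (1 + 3 * x)))"
        using x by (simp add: powr_def)
      also have "\<dots> \<le> \<alpha> / 9 + E"
      proof (cases "x \<le> 1 / 4")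
        case True
        have "exp (2 * x) \<le> 1 + 2 * x + (2 * x)\<^sup>2"
          using x True by (intro exp_bound) auto
        also have "\<dots> \<le> 1 + 3 * x"
          using mult_left_mono[OF True, of "4 * x"] x by (simp add: power2_eq_square algebra_simps)
        finally have "2 * x \<le> ln (1 + 3 * x)"
          using x by (simp add: ln_ge_iff)
        then have "L \<le> real n / 2 * ln (1 + 3 * x)"
          using mult_left_mono[of "2 * x" "ln (1 + 3 * x)" "real n / 2"] x(2) by simp
        then have "exp (- (real n / 2 * ln (1 + 3 * x))) \<le> exp (- L)" by simp
        then show ?thesis using exp_neg_z_const[OF \<alpha>(1)] E0 by (simp add: L_def)
      next
        case False
        have "exp (1 / 12 :: real) \<le> 1 + 1 / 12 + (1 / 12)\<^sup>2" by (intro exp_bound) auto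
        also have "\<dots> \<le> 1 + 3 * x" using False by (simp add: power2_eq_square)
        finally have "1 / 12 \<le> ln (1 + 3 * x)"
          using x by (subst ln_ge_iff) linarith+
        then have "real n / 2 * (1 / 12) \<le> real n / 2 * ln (1 + 3 * x)"
          by (intro mult_left_mono) auto
        then have "exp (- (real n / 2 * ln (1 + 3 * x))) \<le> E" by (simp add: E_def)
        then show ?thesis using \<alpha> by simp
      qed
      finally show ?thesis by (simp add: ennreal_leI)
    qed
    let ?g = "\<lambda>X. ennreal (\<alpha> / 3)
      + (ennreal (exp (- (3 * L / (2 * G)) * (\<Sum>i<n. (w (X i))\<^sup>2))) + indicator bad X)"
    show ?thesis unfolding E_def[symmetric]
    proof (rule coverage_ge[OF n \<sigma> D sD \<theta> \<theta>t refl])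
      fix X assume X: "X \<in> space ?Q"
      let ?fail = "{e \<in> space (noise n \<sigma>). (\<Sum>i<n. (Re (mtrace (X i * (\<theta> - \<theta>t))) + e i)\<^sup>2)
        < real n * \<sigma>\<^sup>2 - sqrt (real n) * \<xi> + (real n * (frob_norm (\<theta> - \<theta>t))\<^sup>2 - 2 * (0 * real d)) / 2
          - sqrt (real n) * zbar n d \<sigma> \<alpha> 0 \<theta>t \<theta>}"
      show "emeasure (noise n \<sigma>) ?fail \<le> ?g X"
      proof (cases "X \<in> bad")
        case True
        then show ?thesis using N.emeasure_le_1[of ?fail] by (simp add: add_increasing)
      next
        case False
        define A where "A = (\<Sum>i<n. (w (X i))\<^sup>2)"
        have A: "2 * A \<ge> G" using False X by (simp add: bad_def A_def)
        have "emeasure (noise n \<sigma>) ?fail \<le> ennreal (\<alpha> / 3) + ennreal (exp (- (3 * L * A / (2 * G))))"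
          using noncoverage_large_signal[OF \<sigma> xi L _ Dv, of A "\<lambda>i. w (X i)"] \<open>\<not> G / 2 \<le> Dv\<close> A G
          by (simp add: A_def w_def G_def Dv_def F)
        then show ?thesis using False by (simp add: A_def)
      qed
    next
      have "(\<integral>\<^sup>+ X. ?g X \<partial>?Q) = ennreal (\<alpha> / 3)
          + ((\<integral>\<^sup>+ X. ennreal (exp (- (3 * L / (2 * G)) * (\<Sum>i<n. (w (X i))\<^sup>2))) \<partial>?Q) + emeasure ?Q bad)"
        by (simp add: nn_integral_add Q.emeasure_space_1)
      also have "\<dots> \<le> ennreal (\<alpha> / 3) + (ennreal (\<alpha> / 9 + E) + ennreal E)"
        by (intro add_mono tail bad order_refl)
      also have "\<dots> = ennreal (\<alpha> / 3 + (\<alpha> / 9 + E + E))"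
        using \<alpha> E0 by (simp add: ennreal_plus[symmetric] add.assoc del: ennreal_plus)
      also have "\<dots> \<le> ennreal (2 * \<alpha> / 3 + 2 * E)"
        using \<alpha> by (intro ennreal_leI) simp
      finally show "(\<integral>\<^sup>+ X. ?g X \<partial>?Q) \<le> ennreal (2 * \<alpha> / 3 + 2 * E)" .
    qed (use \<alpha> E0 in simp)
  qed
qed

section \<open>Designs with independent entries\<close>

text \<open>A measurement \<open>tr (X B)\<close> as a linear form in the entries of \<open>X\<close>, with \<open>m\<close> the transpose of \<open>B\<close>.\<close>

definition design_form :: "nat \<Rightarrow> (nat \<times> nat \<Rightarrow> real) \<Rightarrow> (nat \<times> nat \<Rightarrow> real) \<Rightarrow> real" where
  "design_form d m x = (\<Sum>p\<in>{..<d} \<times> {..<d}. m p * x p)"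

lemma measurable_real_design:
  assumes "sets \<mu> = sets borel"
  shows "(\<lambda>x. Matrix.mat d d (\<lambda>p. complex_of_real (x p))) \<in> iid_entries d \<mu> \<rightarrow>\<^sub>M mat_space d"
  unfolding mat_space_def
proof (rule measurable_vimage_algebra2)
  have c: "(\<lambda>x. x p) \<in> borel_measurable (iid_entries d \<mu>)" if "p \<in> {..<d} \<times> {..<d}" for p
    using measurable_component_singleton[OF that, of "\<lambda>_. \<mu>"] assms
    unfolding iid_entries_def by (simp add: measurable_cong_sets[OF refl assms])
  show "(\<lambda>x. \<lambda>p\<in>{..<d} \<times> {..<d}. Matrix.mat d d (\<lambda>p. complex_of_real (x p)) $$ p)
      \<in> iid_entries d \<mu> \<rightarrow>\<^sub>M (\<Pi>\<^sub>M p\<in>{..<d} \<times> {..<d}. borel)"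
    by (rule measurable_restrict) (use c in \<open>auto intro!: borel_measurable_of_real\<close>)
qed auto

lemma sets_iid_entries_design: "sets (iid_entries_design d \<mu>) = sets (mat_space d)"
  by (simp add: iid_entries_design_def)

lemma prob_space_iid_entries: "prob_space \<mu> \<Longrightarrow> prob_space (iid_entries d \<mu>)"
  unfolding iid_entries_def by (rule prob_space_PiM)

lemma prob_space_iid_entries_design:
  assumes "prob_space \<mu>" "sets \<mu> = sets borel"
  shows "prob_space (iid_entries_design d \<mu>)"
  unfolding iid_entries_design_def
  by (rule prob_space.prob_space_distr[OF prob_space_iid_entries measurable_real_design]) fact+

lemma nn_integral_iid_entries_design:
  assumes sb: "sets \<mu> = sets borel" and B: "B \<in> carrier_mat d d" and f: "f \<in> borel_measurable borel"
  shows "(\<integral>\<^sup>+ X. f (Re (mtrace (X * B))) \<partial>iid_entries_design d \<mu>)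
    = (\<integral>\<^sup>+ x. f (design_form d (\<lambda>p. Re (B $$ (snd p, fst p))) x) \<partial>iid_entries d \<mu>)"
proof -
  have "(\<integral>\<^sup>+ X. f (Re (mtrace (X * B))) \<partial>iid_entries_design d \<mu>)
      = (\<integral>\<^sup>+ x. f (Re (mtrace (Matrix.mat d d (\<lambda>p. complex_of_real (x p)) * B))) \<partial>iid_entries d \<mu>)"
    unfolding iid_entries_design_def
    by (intro nn_integral_distr measurable_real_design[OF sb]
        measurable_compose[OF _ f] measurable_compose[OF _ borel_measurable_Re]
        measurable_mtrace_times[OF sets_distr B])
  moreover have "Re (mtrace (Matrix.mat d d (\<lambda>p. complex_of_real (x p)) * B))
      = design_form d (\<lambda>p. Re (B $$ (snd p, fst p))) x" for x
    unfolding design_form_def mtrace_times[OF mat_carrier B]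
    by (simp add: sum.cartesian_product case_prod_beta mult.commute)
  ultimately show ?thesis by simp
qed

lemma frob_norm_real_entries:
  assumes "B \<in> carrier_mat d d" "real_entries B"
  shows "(frob_norm B)\<^sup>2 = (\<Sum>p\<in>{..<d} \<times> {..<d}. (Re (B $$ (snd p, fst p)))\<^sup>2)"
proof -
  have "(frob_norm B)\<^sup>2 = (\<Sum>i<d. \<Sum>j<d. (cmod (B $$ (i, j)))\<^sup>2)"
    using assms(1) by (simp add: frob_norm_def sum_nonneg)
  also have "\<dots> = (\<Sum>i<d. \<Sum>j<d. (Re (B $$ (i, j)))\<^sup>2)"
    using assms by (intro sum.cong refl) (auto simp: real_entries_def cmod_power2 complex_is_Real_iff)
  also have "\<dots> = (\<Sum>j<d. \<Sum>i<d. (Re (B $$ (i, j)))\<^sup>2)"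
    by (rule sum.swap)
  also have "\<dots> = (\<Sum>p\<in>{..<d} \<times> {..<d}. (Re (B $$ (snd p, fst p)))\<^sup>2)"
    by (simp add: sum.cartesian_product case_prod_beta)
  finally show ?thesis .
qed

lemma real_entries_minus:
  assumes "A \<in> carrier_mat d d" "B \<in> carrier_mat d d" "real_entries A" "real_entries B"
  shows "real_entries (A - B)"
  using assms by (auto simp: real_entries_def)

lemma gaussian_design_mgf:
  assumes "B \<in> carrier_mat d d" "real_entries B" "l \<ge> 0"
  shows "(\<integral>\<^sup>+ X. ennreal (exp (- l * (Re (mtrace (X * B)))\<^sup>2)) \<partial>iid_entries_design d (gaussian 1))
    = ennreal (1 / sqrt (1 + 2 * l * (frob_norm B)\<^sup>2))"
  using nn_integral_iid_entries_design[OF sets_gaussian[of 1] assms(1), of "\<lambda>t. ennreal (exp (- l * t\<^sup>2))"]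
    PiM_gaussian_exp_neg_square[OF _ assms(3), of "{..<d} \<times> {..<d}" "\<lambda>p. Re (B $$ (snd p, fst p))"]
  by (simp add: frob_norm_real_entries[OF assms(1,2)] design_form_def iid_entries_def)

text \<open>
  Off-diagonal products have mean zero. Each product of two coordinates is written as a product over the
  whole index set, with factors \<open>1\<close> elsewhere, to evaluate it under the product measure.
\<close>

lemma iid_second_moment:
  assumes \<mu>: "centered_unit_variance \<mu>" and I: "finite I"
  shows "integrable (\<Pi>\<^sub>M p\<in>I. \<mu>) (\<lambda>x. (\<Sum>p\<in>I. m p * x p)\<^sup>2)" (is ?int)
    and "(\<integral>x. (\<Sum>p\<in>I. m p * x p)\<^sup>2 \<partial>(\<Pi>\<^sub>M p\<in>I. \<mu>)) = (\<Sum>p\<in>I. (m p)\<^sup>2)" (is ?val)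
proof -
  interpret prob_space \<mu> using \<mu> by (simp add: centered_unit_variance_def)
  interpret PS: product_sigma_finite "\<lambda>_. \<mu>"
    by (simp add: product_sigma_finite_def sigma_finite_measure_axioms)
  have m1: "integrable \<mu> (\<lambda>x. x)" "(\<integral>x. x \<partial>\<mu>) = 0" "integrable \<mu> (\<lambda>x. x\<^sup>2)" "(\<integral>x. x\<^sup>2 \<partial>\<mu>) = 1"
    using \<mu> by (auto simp: centered_unit_variance_def)
  define f where "f p q i t = (if i = p then t else 1) * (if i = q then t else 1 :: real)" for p q i :: 'a and t :: real
  have f: "integrable \<mu> (f p q i)" for p q i
    using m1 by (cases "i = p"; cases "i = q") (auto simp: f_def[abs_def] power2_eq_square)
  have prod: "(\<Prod>i\<in>I. f p q i (x i)) = x p * x q" if "p \<in> I" "q \<in> I" for p q x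
    using that I by (simp add: f_def prod.distrib)
  have int2: "integrable (\<Pi>\<^sub>M p\<in>I. \<mu>) (\<lambda>x. x p * x q)" if "p \<in> I" "q \<in> I" for p q
    using PS.product_integrable_prod[OF I, of "f p q"] f prod[OF that] by simp
  have val2: "(\<integral>x. x p * x q \<partial>(\<Pi>\<^sub>M p\<in>I. \<mu>)) = (if p = q then 1 else 0)" if "p \<in> I" "q \<in> I" for p q
  proof -
    have "(\<integral>x. x p * x q \<partial>(\<Pi>\<^sub>M p\<in>I. \<mu>)) = (\<Prod>i\<in>I. \<integral>t. f p q i t \<partial>\<mu>)"
      using PS.product_integral_prod[OF I, of "f p q"] f prod[OF that] by simp
    also have "\<dots> = (if p = q then 1 else 0)"
    proof (cases "p = q")
      case True
      then have "(\<integral>t. f p q i t \<partial>\<mu>) = 1" for i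
        using m1 by (cases "i = q") (auto simp: f_def power2_eq_square prob_space)
      then show ?thesis using True by simp
    next
      case False
      then have "(\<integral>t. f p q p t \<partial>\<mu>) = 0" using m1 by (simp add: f_def)
      then show ?thesis using False I that by (auto intro: prod_zero)
    qed
    finally show ?thesis .
  qed
  have expand: "(\<Sum>p\<in>I. m p * x p)\<^sup>2 = (\<Sum>p\<in>I. \<Sum>q\<in>I. m p * m q * (x p * x q))" for x
    by (simp add: power2_eq_square sum_product mult_ac)
  show ?int unfolding expand using int2 by auto
  have "(\<integral>x. (\<Sum>p\<in>I. m p * x p)\<^sup>2 \<partial>(\<Pi>\<^sub>M p\<in>I. \<mu>))
      = (\<Sum>p\<in>I. \<Sum>q\<in>I. m p * m q * (\<integral>x. x p * x q \<partial>(\<Pi>\<^sub>M p\<in>I. \<mu>)))"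
    unfolding expand using int2 by (simp add: integrable_sum)
  also have "\<dots> = (\<Sum>p\<in>I. \<Sum>q\<in>I. if p = q then m p * m q else 0)"
    by (intro sum.cong refl) (simp add: val2)
  also have "\<dots> = (\<Sum>p\<in>I. (m p)\<^sup>2)"
    using I by (simp add: power2_eq_square)
  finally show ?val .
qed

text \<open>
  From \<open>v / 4 \<le> exp (v / 4)\<close>, raised to the fourth power. The value \<open>256\<close> only affects the unspecified
  constant of the sub-Gaussian design.
\<close>

lemma power4_le_exp: "u ^ 4 \<le> 256 * (exp u + exp (- u))" for u :: real
proof -
  have *: "v ^ 4 \<le> 256 * exp v" if "v \<ge> 0" for v :: real
  proof -
    have "v / 4 \<le> exp (v / 4)" using exp_ge_add_one_self[of "v / 4"] by linarith
    then have "(v / 4) ^ 4 \<le> exp (v / 4) ^ 4" using that by (intro power_mono) auto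
    also have "\<dots> = exp v" by (simp add: exp_of_nat_mult[symmetric])
    finally show ?thesis by (simp add: power_divide)
  qed
  show ?thesis
  proof (cases "u \<ge> 0")
    case True
    then show ?thesis using *[of u] exp_gt_zero[of "- u"] by argo
  next
    case False
    then show ?thesis using *[of "- u"] by (simp add: add_increasing)
  qed
qed

text \<open>
  After scaling \<open>m\<close> to unit norm, the exponential moments at \<open>l = 1\<close> and \<open>l = - 1\<close> dominate the fourth
  moment; this also gives integrability.
\<close>

lemma subgaussian_fourth_moment:
  assumes \<mu>: "prob_space \<mu>" "sets \<mu> = sets borel" and sg: "subgaussian_design d \<mu> \<tau>1 \<tau>2" and \<tau>: "\<tau>1 > 0"
    and F: "F = (\<Sum>p\<in>{..<d} \<times> {..<d}. (m p)\<^sup>2)" "F > 0"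
  shows "integrable (iid_entries d \<mu>) (\<lambda>x. (design_form d m x) ^ 4)" (is ?int)
    and "(\<integral>x. (design_form d m x) ^ 4 \<partial>iid_entries d \<mu>) \<le> 512 * \<tau>1 * exp (\<tau>2\<^sup>2) * F\<^sup>2" (is ?val)
proof -
  let ?P = "iid_entries d \<mu>"
  define N where "N = Matrix.mat d d (\<lambda>(k, i). m (i, k) / sqrt F)"
  have N: "N \<in> carrier_mat d d" by (simp add: N_def)
  have "(\<Sum>i<d. \<Sum>j<d. (m (j, i))\<^sup>2) = F"
    unfolding F by (subst sum.swap) (simp add: sum.cartesian_product)
  then have "frob_norm N = 1"
    using F(2) by (simp add: frob_norm_def N_def power_divide sum_divide_distrib[symmetric])
  have tr: "mtrace (Matrix.mat d d x * N) = design_form d m x / sqrt F" for x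
    unfolding mtrace_times[OF mat_carrier N] design_form_def
    by (simp add: N_def sum.cartesian_product case_prod_beta sum_divide_distrib mult.commute)
  have mgf: "(\<integral>\<^sup>+ x. ennreal (exp (l * (design_form d m x / sqrt F))) \<partial>?P) \<le> ennreal (\<tau>1 * exp (\<tau>2\<^sup>2))"
    if "l\<^sup>2 = 1" for l
    using sg[unfolded subgaussian_design_def, rule_format, OF N, of l] that
    by (simp add: \<open>frob_norm N = 1\<close> tr)
  have c: "(\<lambda>x. x p) \<in> borel_measurable ?P" if "p \<in> {..<d} \<times> {..<d}" for p
    using measurable_component_singleton[OF that, of "\<lambda>_. \<mu>"]
    unfolding iid_entries_def by (simp add: measurable_cong_sets[OF refl \<mu>(2)])
  have meas[measurable]: "design_form d m \<in> borel_measurable ?P"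
    unfolding design_form_def[abs_def]
    by (intro borel_measurable_sum borel_measurable_times borel_measurable_const c) auto
  have pt: "(design_form d m x) ^ 4
      \<le> 256 * F\<^sup>2 * (exp (1 * (design_form d m x / sqrt F)) + exp (- 1 * (design_form d m x / sqrt F)))" for x
  proof -
    have s4: "sqrt F ^ 4 = F\<^sup>2" using F(2) by (metis less_imp_le numeral_Bit0_eq_double power_mult real_sqrt_pow2)
    have "(design_form d m x) ^ 4 = F\<^sup>2 * (design_form d m x / sqrt F) ^ 4"
      using F(2) by (simp add: power_divide s4)
    also have "\<dots> \<le> F\<^sup>2 * (256 * (exp (design_form d m x / sqrt F) + exp (- (design_form d m x / sqrt F))))"
      by (intro mult_left_mono power4_le_exp) auto
    finally show ?thesis by (simp add: mult_ac)
  qed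
  have "(\<integral>\<^sup>+ x. ennreal ((design_form d m x) ^ 4) \<partial>?P)
      \<le> (\<integral>\<^sup>+ x. ennreal (256 * F\<^sup>2) * (ennreal (exp (1 * (design_form d m x / sqrt F)))
          + ennreal (exp (- 1 * (design_form d m x / sqrt F)))) \<partial>?P)"
    using pt by (intro nn_integral_mono) (auto simp: ennreal_mult[symmetric] ennreal_leI simp flip: ennreal_plus)
  also have "\<dots> = ennreal (256 * F\<^sup>2) * ((\<integral>\<^sup>+ x. ennreal (exp (1 * (design_form d m x / sqrt F))) \<partial>?P)
          + (\<integral>\<^sup>+ x. ennreal (exp (- 1 * (design_form d m x / sqrt F))) \<partial>?P))"
    by (simp add: nn_integral_cmult nn_integral_add)
  also have "\<dots> \<le> ennreal (256 * F\<^sup>2) * (ennreal (\<tau>1 * exp (\<tau>2\<^sup>2)) + ennreal (\<tau>1 * exp (\<tau>2\<^sup>2)))"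
    by (intro mult_left_mono add_mono mgf) auto
  also have "\<dots> = ennreal (512 * \<tau>1 * exp (\<tau>2\<^sup>2) * F\<^sup>2)"
    using \<tau> by (simp add: ennreal_plus[symmetric] ennreal_mult[symmetric] mult_ac del: ennreal_plus)
  finally have nn: "(\<integral>\<^sup>+ x. ennreal ((design_form d m x) ^ 4) \<partial>?P) \<le> ennreal (512 * \<tau>1 * exp (\<tau>2\<^sup>2) * F\<^sup>2)" .
  show int: ?int
  proof (rule integrableI_bounded)
    show "(\<integral>\<^sup>+ x. ennreal (norm ((design_form d m x) ^ 4)) \<partial>?P) < \<infinity>"
      using nn by (simp add: le_less_trans[OF _ ennreal_less_top])
  qed measurable
  show ?val
  proof -
    have "ennreal (\<integral>x. (design_form d m x) ^ 4 \<partial>?P) \<le> ennreal (512 * \<tau>1 * exp (\<tau>2\<^sup>2) * F\<^sup>2)"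
      using nn nn_integral_eq_integral[OF int] by simp
    then show ?thesis using \<tau> by (simp add: ennreal_le_iff)
  qed
qed

lemma subgaussian_design_mgf:
  assumes \<mu>: "centered_unit_variance \<mu>" and sg: "subgaussian_design d \<mu> \<tau>1 \<tau>2" and \<tau>: "\<tau>1 > 0"
    and B: "B \<in> carrier_mat d d" "real_entries B" and F: "F = (frob_norm B)\<^sup>2" "F > 0" and l: "l \<ge> 0"
  shows "(\<integral>\<^sup>+ X. ennreal (exp (- l * (Re (mtrace (X * B)))\<^sup>2)) \<partial>iid_entries_design d \<mu>)
    \<le> ennreal (exp (- l * F + l\<^sup>2 * (512 * \<tau>1 * exp (\<tau>2\<^sup>2) * F\<^sup>2) / 2))"
proof -
  have ps: "prob_space \<mu>" "sets \<mu> = sets borel" using \<mu> by (auto simp: centered_unit_variance_def)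
  define m where "m p = Re (B $$ (snd p, fst p))" for p
  have Fm: "F = (\<Sum>p\<in>{..<d} \<times> {..<d}. (m p)\<^sup>2)"
    unfolding F(1) frob_norm_real_entries[OF B] m_def ..
  have "(\<integral>\<^sup>+ X. ennreal (exp (- l * (Re (mtrace (X * B)))\<^sup>2)) \<partial>iid_entries_design d \<mu>)
      = (\<integral>\<^sup>+ x. ennreal (exp (- l * (design_form d m x)\<^sup>2)) \<partial>iid_entries d \<mu>)"
    using nn_integral_iid_entries_design[OF ps(2) B(1), of "\<lambda>t. ennreal (exp (- l * t\<^sup>2))"]
    by (simp add: m_def[abs_def])
  also have "\<dots> \<le> ennreal (exp (- l * F + l\<^sup>2 * (512 * \<tau>1 * exp (\<tau>2\<^sup>2) * F\<^sup>2) / 2))"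
    using iid_second_moment[OF \<mu>, of "{..<d} \<times> {..<d}" m]
    by (intro nn_integral_exp_neg_square_le prob_space_iid_entries ps l
        subgaussian_fourth_moment[OF ps sg \<tau> Fm F(2)])
       (simp_all add: design_form_def iid_entries_def Fm)
  finally show ?thesis .
qed

text \<open>
  The fourth moment scales like \<open>F\<^sup>2\<close>, so \<open>F\<close> cancels from the exponent and the constant is uniform in
  \<open>\<theta>\<close> and in the dimension.
\<close>

lemma coverage_subgaussian:
  assumes \<mu>: "centered_unit_variance \<mu>" and sg: "subgaussian_design d \<mu> \<tau>1 \<tau>2" and \<tau>: "\<tau>1 > 0"
    and n: "n \<ge> 1" and \<sigma>: "\<sigma> > 0" and \<alpha>: "0 < \<alpha>" "\<alpha> < 1" and xi: "is_xi n \<sigma> (\<alpha> / 3) \<xi>"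
    and \<theta>: "\<theta> \<in> hermitian_mats d" "real_entries \<theta>" and \<theta>t: "\<theta>t \<in> hermitian_mats d" "real_entries \<theta>t"
  shows "coverage n d (iid_entries_design d \<mu>) \<sigma> \<alpha> \<xi> 0 \<theta>t \<theta>
    \<ge> 1 - (2 * \<alpha> / 3 + exp (- (1 / (9216 * \<tau>1 * exp (\<tau>2\<^sup>2))) * real n))"
proof -
  have ps: "prob_space \<mu>" "sets \<mu> = sets borel" using \<mu> by (auto simp: centered_unit_variance_def)
  define F where "F = (frob_norm (\<theta> - \<theta>t))\<^sup>2"
  define c where "c = 512 * \<tau>1 * exp (\<tau>2\<^sup>2)"
  have c0: "c > 0" using \<tau> by (simp add: c_def)
  have cM: "\<theta> - \<theta>t \<in> carrier_mat d d" "real_entries (\<theta> - \<theta>t)"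
    using \<theta> \<theta>t by (auto intro!: real_entries_minus simp: hermitian_mats_def)
  have D: "prob_space (iid_entries_design d \<mu>)" by (rule prob_space_iid_entries_design[OF ps])
  show ?thesis
  proof (cases "F > 0")
    case True
    have "coverage n d (iid_entries_design d \<mu>) \<sigma> \<alpha> \<xi> 0 \<theta>t \<theta>
      \<ge> 1 - (2 * \<alpha> / 3 + exp (- ((real n * F + 4 * 0 * real d) / 3)\<^sup>2 / (2 * real n * (c * F\<^sup>2))))"
      using subgaussian_design_mgf[OF \<mu> sg \<tau> cM F_def True] c0 True
      by (intro coverage_ge_of_energy_mgf[OF n \<sigma> D sets_iid_entries_design \<theta>(1) \<theta>t(1) \<alpha> xi _ F_def])
         (auto simp: c_def)
    also have "- ((real n * F + 4 * 0 * real d) / 3)\<^sup>2 / (2 * real n * (c * F\<^sup>2)) = - (1 / (18 * c)) * real n"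
      using True n c0 by (simp add: field_simps power2_eq_square)
    finally show ?thesis by (simp add: c_def mult.assoc)
  next
    case False
    then have "F = 0" by (simp add: F_def)
    then have "coverage n d (iid_entries_design d \<mu>) \<sigma> \<alpha> \<xi> 0 \<theta>t \<theta> \<ge> 1 - \<alpha> / 3"
      using zbar_ge(2)[OF \<alpha> \<sigma> order_refl refl, of n d 0 \<theta>t \<theta>]
      by (intro coverage_small_signal[OF n \<sigma> D sets_iid_entries_design \<theta>(1) \<theta>t(1) \<alpha>(1) xi])
         (simp add: F_def)
    moreover have "exp (- (1 / (9216 * \<tau>1 * exp (\<tau>2\<^sup>2))) * real n) > 0" by simp
    ultimately show ?thesis using \<alpha> by linarith
  qed
qed

lemma coverage_gaussian:
  assumes n: "n \<ge> 1" and \<sigma>: "\<sigma> > 0" and \<alpha>: "0 < \<alpha>" "\<alpha> < 1" and xi: "is_xi n \<sigma> (\<alpha> / 3) \<xi>"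
    and \<theta>: "\<theta> \<in> hermitian_mats d" "real_entries \<theta>" and \<theta>t: "\<theta>t \<in> hermitian_mats d" "real_entries \<theta>t"
  shows "coverage n d (iid_entries_design d (gaussian 1)) \<sigma> \<alpha> \<xi> 0 \<theta>t \<theta>
    \<ge> 1 - (2 * \<alpha> / 3 + 2 * exp (- (1 / 24) * real n))"
proof -
  have cM: "\<theta> - \<theta>t \<in> carrier_mat d d" "real_entries (\<theta> - \<theta>t)"
    using \<theta> \<theta>t by (auto intro!: real_entries_minus simp: hermitian_mats_def)
  have "prob_space (iid_entries_design d (gaussian 1))"
    by (intro prob_space_iid_entries_design prob_space_gaussian) auto
  then show ?thesis
    by (rule coverage_ge_of_gaussian_mgf[OF n \<sigma> _ sets_iid_entries_design \<theta>(1) \<theta>t(1) \<alpha> xi refl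
        gaussian_design_mgf[OF cM]])
qed

section \<open>Trace duality for states\<close>

definition quad_form :: "nat \<Rightarrow> (nat \<Rightarrow> nat \<Rightarrow> complex) \<Rightarrow> (nat \<Rightarrow> complex) \<Rightarrow> complex" where
  "quad_form d a v = (\<Sum>i<d. \<Sum>j<d. cnj (v i) * a i j * v j)"

text \<open>
  Expansion of a Hermitian form along the coordinate vector \<open>m\<close>. Optimising over \<open>t\<close> makes this the
  device for eliminating a pivot.
\<close>

lemma quad_form_shift:
  assumes herm: "\<And>i j. i < d \<Longrightarrow> j < d \<Longrightarrow> a j i = cnj (a i j)" and m: "m < d"
  shows "quad_form d a (\<lambda>i. v i + (if i = m then t else 0))
    = quad_form d a v + cnj t * (\<Sum>j<d. a m j * v j) + t * cnj (\<Sum>j<d. a m j * v j) + cnj t * t * a m m"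
proof -
  have sift: "(\<Sum>j<d. (if j = m then f j else 0)) = f m" for f :: "nat \<Rightarrow> complex"
    using m by simp
  have col: "(\<Sum>i<d. cnj (v i) * a i m) = cnj (\<Sum>j<d. a m j * v j)"
    using herm[OF m] by (simp add: cnj_sum mult.commute)
  have "quad_form d a (\<lambda>i. v i + (if i = m then t else 0))
      = (\<Sum>i<d. \<Sum>j<d. cnj (v i) * a i j * v j
          + (if i = m then cnj t * a i j * v j else 0)
          + (if j = m then cnj (v i) * a i j * t else 0)
          + (if j = m then (if i = m then cnj t * a i j * t else 0) else 0))"
    unfolding quad_form_def by (intro sum.cong refl) (simp add: algebra_simps)
  also have "\<dots> = quad_form d a v
      + (\<Sum>i<d. \<Sum>j<d. if i = m then cnj t * a i j * v j else 0)
      + (\<Sum>i<d. cnj (v i) * a i m * t) + (\<Sum>i<d. if i = m then cnj t * a i m * t else 0)"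
    unfolding sum.distrib quad_form_def by (simp only: sift)
  also have "(\<Sum>i<d. \<Sum>j<d. if i = m then cnj t * a i j * v j else 0) = cnj t * (\<Sum>j<d. a m j * v j)"
    by (subst sum.swap) (simp add: sift sum_distrib_left mult.assoc)
  also have "(\<Sum>i<d. cnj (v i) * a i m * t) = t * (\<Sum>i<d. cnj (v i) * a i m)"
    by (simp add: sum_distrib_left mult_ac)
  also have "(\<Sum>i<d. if i = m then cnj t * a i m * t else 0) = cnj t * t * a m m"
    unfolding sift by simp
  finally show ?thesis unfolding col .
qed

text \<open>
  The trace of a product of two positive semidefinite matrices is nonnegative. This follows from one
  pivot step of Cholesky's decomposition, repeated: subtracting the rank-one matrix built from column
  \<open>m\<close> leaves a positive semidefinite matrix whose row \<open>m\<close> vanishes, and the rank-one part contributes a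
  value of the quadratic form of \<open>H\<close>. The induction is on the number of leading rows that may be
  nonzero.
\<close>

lemma sum_product_psd_nonneg:
  assumes "\<And>i j. i < d \<Longrightarrow> j < d \<Longrightarrow> a j i = cnj (a i j)"
    and "\<And>v. 0 \<le> Re (quad_form d a v)"
    and H: "\<And>v. 0 \<le> Re (quad_form d H v)"
  shows "0 \<le> Re (\<Sum>i<d. \<Sum>j<d. a i j * H j i)"
proof -
  have "0 \<le> Re (\<Sum>i<d. \<Sum>j<d. a i j * H j i)"
    if "\<And>i j. i < d \<Longrightarrow> j < d \<Longrightarrow> m \<le> i \<Longrightarrow> a i j = 0"
      "\<And>i j. i < d \<Longrightarrow> j < d \<Longrightarrow> a j i = cnj (a i j)" "\<And>v. 0 \<le> Re (quad_form d a v)" for m a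
    using that
  proof (induction m arbitrary: a)
    case 0
    show ?case using 0(1) by simp
  next
    case (Suc m)
    note supp = Suc.prems(1) and herm = Suc.prems(2) and psd = Suc.prems(3)
    show ?case
    proof (cases "m < d")
      case False
      then show ?thesis by (intro Suc.IH herm psd) auto
    next
      case m: True
      have "a m m = cnj (a m m)" using herm[OF m m] .
      then have real: "a m m = complex_of_real (Re (a m m))"
        by (simp add: complex_eq_iff)
      define p where "p = Re (a m m)"
      have shift: "0 \<le> Re (quad_form d a v) + 2 * Re (cnj t * (\<Sum>j<d. a m j * v j)) + (cmod t)\<^sup>2 * p" for v t
      proof -
        define \<beta> where "\<beta> = (\<Sum>j<d. a m j * v j)"
        have "cnj t * t = complex_of_real ((cmod t)\<^sup>2)"
          by (simp only: complex_norm_square mult.commute)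
        then have e1: "Re (cnj t * t * a m m) = (cmod t)\<^sup>2 * p" by (simp add: p_def)
        have e2: "Re (t * cnj \<beta>) = Re (cnj t * \<beta>)" by simp
        have qs: "quad_form d a (\<lambda>i. v i + (if i = m then t else 0))
            = quad_form d a v + cnj t * \<beta> + t * cnj \<beta> + cnj t * t * a m m"
          unfolding \<beta>_def by (rule quad_form_shift[OF herm m])
        have "0 \<le> Re (quad_form d a v + cnj t * \<beta> + t * cnj \<beta> + cnj t * t * a m m)"
          unfolding qs[symmetric] by (rule psd)
        then show ?thesis
          unfolding plus_complex.simps e1 e2 \<beta>_def[symmetric] by linarith
      qed
      have "p \<ge> 0" using shift[of "\<lambda>_. 0" 1] by (simp add: quad_form_def)
      show ?thesis
      proof (cases "p = 0")
        case True
        have row: "a m j = 0" if j: "j < d" for j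
        proof (rule ccontr)
          assume nz: "a m j \<noteq> 0"
          define c where "c = (cmod (a m j))\<^sup>2"
          have c: "c > 0" using nz by (simp add: c_def)
          let ?v = "\<lambda>i. if i = j then 1 else 0 :: complex"
          have s: "(\<Sum>i<d. a m i * ?v i) = a m j" using j by (simp add: if_distrib cong: if_cong)
          define R where "R = Re (quad_form d a ?v)"
          \<comment> \<open>A multiple of the offending entry large enough to make the form negative along \<open>e\<^sub>j + t e\<^sub>m\<close>.\<close>
          define t where "t = complex_of_real (- (R + 1) / (2 * c)) * a m j"
          have "cnj t * a m j = complex_of_real (- (R + 1) / (2 * c)) * complex_of_real c"
            unfolding t_def c_def by (simp only: complex_cnj_mult complex_cnj_complex_of_real mult.assoc
                complex_norm_square mult.commute[of "cnj (a m j)"])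
          also have "\<dots> = complex_of_real (- (R + 1) / (2 * c) * c)" by (rule of_real_mult[symmetric])
          also have "- (R + 1) / (2 * c) * c = - (R + 1) / 2" using c by simp
          finally have e: "Re (cnj t * a m j) = - (R + 1) / 2" by (simp only: Re_complex_of_real)
          show False
            using shift[of ?v t] True unfolding s R_def[symmetric] e by (simp add: field_simps)
        qed
        show ?thesis
        proof (rule Suc.IH[OF _ herm psd])
          fix i j assume "i < d" "j < d" "m \<le> i"
          then show "a i j = 0" using supp row by (cases "i = m") auto
        qed
      next
        case False
        then have p: "p > 0" using \<open>p \<ge> 0\<close> by simp
        have amm: "a m m = complex_of_real p" unfolding p_def by (rule real)
        define a' where "a' i j = a i j - a i m * a m j / complex_of_real p" for i j
        have IH: "0 \<le> Re (\<Sum>i<d. \<Sum>j<d. a' i j * H j i)"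
        proof (rule Suc.IH)
          fix i j assume ij: "i < d" "j < d"
          show "a' j i = cnj (a' i j)"
            using herm[OF ij] herm[OF ij(1) m] herm[OF m ij(2)] by (simp add: a'_def mult.commute)
          show "m \<le> i \<Longrightarrow> a' i j = 0"
            using supp[OF ij] supp[OF ij(1) m] amm p by (cases "i = m") (auto simp: a'_def)
        next
          fix v
          define \<beta> where "\<beta> = (\<Sum>j<d. a m j * v j)"
          have col: "(\<Sum>i<d. cnj (v i) * a i m) = cnj \<beta>"
            using herm[OF m] by (simp add: \<beta>_def cnj_sum mult.commute)
          have bb: "cnj \<beta> * \<beta> = complex_of_real ((cmod \<beta>)\<^sup>2)"
            by (simp only: complex_norm_square mult.commute)
          have "quad_form d a' v = quad_form d a v - (\<Sum>i<d. \<Sum>j<d. cnj (v i) * a i m * (a m j * v j)) / complex_of_real p"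
            by (simp add: quad_form_def a'_def algebra_simps sum_subtractf sum_divide_distrib)
          also have "(\<Sum>i<d. \<Sum>j<d. cnj (v i) * a i m * (a m j * v j)) = cnj \<beta> * \<beta>"
            unfolding col[symmetric] unfolding \<beta>_def sum_product ..
          also note bb
          finally have q': "Re (quad_form d a' v) = Re (quad_form d a v) - (cmod \<beta>)\<^sup>2 / p"
            by (simp flip: of_real_divide)
          \<comment> \<open>The minimiser of the shifted form over \<open>t\<close>; the minimum is the form of the reduced matrix.\<close>
          define t where "t = - \<beta> / complex_of_real p"
          have "cnj t * \<beta> = complex_of_real (- ((cmod \<beta>)\<^sup>2 / p))"
          proof -
            have "cnj t * \<beta> = - (cnj \<beta> * \<beta>) / complex_of_real p" by (simp add: t_def)
            then show ?thesis unfolding bb by simp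
          qed
          moreover have "(cmod t)\<^sup>2 * p = (cmod \<beta>)\<^sup>2 / p"
            using p by (simp add: t_def norm_divide power_divide power2_eq_square)
          ultimately show "0 \<le> Re (quad_form d a' v)"
            using shift[of v t] unfolding q' \<beta>_def[symmetric] by simp
        qed
        have "(\<Sum>i<d. \<Sum>j<d. a i j * H j i) = (\<Sum>i<d. \<Sum>j<d. a' i j * H j i)
            + (\<Sum>i<d. \<Sum>j<d. a m j * H j i * a i m) / complex_of_real p"
          by (simp add: a'_def algebra_simps sum_subtractf sum_divide_distrib)
        also have "(\<Sum>i<d. \<Sum>j<d. a m j * H j i * a i m) = (\<Sum>j<d. \<Sum>i<d. a m j * H j i * a i m)"
          by (rule sum.swap)
        also have "\<dots> = quad_form d H (\<lambda>i. a i m)"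
          unfolding quad_form_def using herm[OF _ m] by (intro sum.cong refl) simp
        finally have split: "(\<Sum>i<d. \<Sum>j<d. a i j * H j i)
            = (\<Sum>i<d. \<Sum>j<d. a' i j * H j i) + quad_form d H (\<lambda>i. a i m) / complex_of_real p" .
        have "0 \<le> Re (quad_form d H (\<lambda>i. a i m)) / p" using H p by simp
        then show ?thesis
          using IH unfolding split plus_complex.simps Re_divide_of_real by linarith
      qed
    qed
  qed
  note supported = this
  show ?thesis by (rule supported[of d a]) (simp, rule assms(1), assumption+, rule assms(2))
qed

lemma hermitian_index:
  assumes "A \<in> hermitian_mats d" "i < d" "j < d"
  shows "A $$ (j, i) = cnj (A $$ (i, j))"
proof -
  have A: "A \<in> carrier_mat d d" "mat_adjoint A = A" using assms(1) by (auto simp: hermitian_mats_def)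
  have "mat_adjoint A $$ (j, i) = cnj (A $$ (i, j))"
    using A(1) assms(2,3) by (auto simp: mat_adjoint_def mat_of_rows_def)
  then show ?thesis by (simp add: A(2))
qed

lemma mult_mat_vec_inner:
  assumes "A \<in> carrier_mat d d"
  shows "(A *\<^sub>v Matrix.vec d v) \<bullet>c Matrix.vec d v = quad_form d (\<lambda>i j. A $$ (i, j)) v"
proof -
  have "(A *\<^sub>v Matrix.vec d v) \<bullet>c Matrix.vec d v = (\<Sum>i<d. (\<Sum>j<d. A $$ (i, j) * v j) * cnj (v i))"
    using assms by (simp add: scalar_prod_def atLeast0LessThan)
  also have "\<dots> = quad_form d (\<lambda>i j. A $$ (i, j)) v"
    unfolding quad_form_def sum_distrib_right by (intro sum.cong refl) (simp only: mult_ac)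
  finally show ?thesis .
qed

lemma vec_l2_norm_L2_set: "vec_l2_norm v = L2_set (\<lambda>i. cmod (vec_index v i)) {..<dim_vec v}"
  by (simp add: vec_l2_norm_def L2_set_def)

text \<open>
  The supremum that defines the operator norm is over a bounded set, since the coordinates of a vector
  of norm at most one are at most one in modulus.
\<close>

lemma vec_l2_norm_le_op_norm:
  assumes E: "E \<in> carrier_mat d d" and v: "v \<in> carrier_vec d" "vec_l2_norm v \<le> 1"
  shows "vec_l2_norm (E *\<^sub>v v) \<le> op_norm E"
  unfolding op_norm_def
proof (rule cSUP_upper)
  show "v \<in> {v \<in> carrier_vec (dim_col E). vec_l2_norm v \<le> 1}" using E v by simp
  show "bdd_above ((\<lambda>v. vec_l2_norm (E *\<^sub>v v)) ` {v \<in> carrier_vec (dim_col E). vec_l2_norm v \<le> 1})"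
  proof (rule bdd_aboveI2)
    fix u :: "complex Matrix.vec" assume "u \<in> {v \<in> carrier_vec (dim_col E). vec_l2_norm v \<le> 1}"
    then have u: "dim_vec u = d" "vec_l2_norm u \<le> 1" using E by auto
    have u1: "cmod (vec_index u j) \<le> 1" if "j < d" for j
      using member_le_L2_set[of "{..<d}" j "\<lambda>i. cmod (vec_index u i)"] u that
      by (simp add: vec_l2_norm_L2_set)
    have "cmod (vec_index (E *\<^sub>v u) i) \<le> (\<Sum>j<d. cmod (E $$ (i, j)))" if "i < d" for i
    proof -
      have "cmod (vec_index (E *\<^sub>v u) i) = cmod (\<Sum>j<d. E $$ (i, j) * vec_index u j)"
        using E u that by (simp add: scalar_prod_def atLeast0LessThan)
      also have "\<dots> \<le> (\<Sum>j<d. cmod (E $$ (i, j)) * cmod (vec_index u j))"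
        by (rule sum_norm_le) (simp add: norm_mult)
      also have "\<dots> \<le> (\<Sum>j<d. cmod (E $$ (i, j)) * 1)"
        using u1 by (intro sum_mono mult_left_mono) auto
      finally show ?thesis by simp
    qed
    moreover have "dim_vec (E *\<^sub>v u) = d" using E by simp
    ultimately show "vec_l2_norm (E *\<^sub>v u) \<le> L2_set (\<lambda>i. \<Sum>j<d. cmod (E $$ (i, j))) {..<d}"
      unfolding vec_l2_norm_L2_set by (simp only:, intro L2_set_mono) (auto simp: sum_nonneg)
  qed
qed

lemma quad_form_le_op_norm:
  assumes E: "E \<in> carrier_mat d d"
  shows "cmod (quad_form d (\<lambda>i j. E $$ (i, j)) v) \<le> op_norm E * (\<Sum>i<d. (cmod (v i))\<^sup>2)"
proof -
  define N where "N = (\<Sum>i<d. (cmod (v i))\<^sup>2)"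
  have N0: "N \<ge> 0" by (simp add: N_def sum_nonneg)
  show ?thesis
  proof (cases "N = 0")
    case True
    then have "v i = 0" if "i < d" for i
      using that by (simp add: N_def sum_nonneg_eq_0_iff)
    then have "quad_form d (\<lambda>i j. E $$ (i, j)) v = 0" by (simp add: quad_form_def)
    then show ?thesis using True by (simp add: N_def[symmetric])
  next
    case False
    then have N: "N > 0" using N0 by simp
    define u where "u i = v i / complex_of_real (sqrt N)" for i
    let ?u = "Matrix.vec d u"
    have "(\<Sum>i<d. (cmod (u i))\<^sup>2) = 1"
      using N by (simp add: u_def norm_divide power_divide sum_divide_distrib[symmetric] N_def[symmetric])
    then have u1: "vec_l2_norm ?u = 1" by (simp add: vec_l2_norm_def)
    have "quad_form d (\<lambda>i j. E $$ (i, j)) u = quad_form d (\<lambda>i j. E $$ (i, j)) v / complex_of_real N"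
    proof -
      have ss: "complex_of_real (sqrt N) * complex_of_real (sqrt N) = complex_of_real N"
        using N by (simp flip: of_real_mult)
      have "cnj (u i) * E $$ (i, j) * u j = cnj (v i) * E $$ (i, j) * v j / complex_of_real N" for i j
        unfolding u_def ss[symmetric] by simp
      then show ?thesis by (simp add: quad_form_def sum_divide_distrib)
    qed
    then have "cmod (quad_form d (\<lambda>i j. E $$ (i, j)) v) = N * cmod (quad_form d (\<lambda>i j. E $$ (i, j)) u)"
      using N by (simp add: norm_divide)
    also have "cmod (quad_form d (\<lambda>i j. E $$ (i, j)) u) \<le> op_norm E"
    proof -
      have "cmod (quad_form d (\<lambda>i j. E $$ (i, j)) u) = cmod (\<Sum>i<d. vec_index (E *\<^sub>v ?u) i * cnj (u i))"
        unfolding mult_mat_vec_inner[OF E, symmetric] using E by (simp add: scalar_prod_def atLeast0LessThan)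
      also have "\<dots> \<le> (\<Sum>i<d. \<bar>cmod (vec_index (E *\<^sub>v ?u) i)\<bar> * \<bar>cmod (u i)\<bar>)"
        by (rule sum_norm_le) (simp add: norm_mult)
      also have "\<dots> \<le> L2_set (\<lambda>i. cmod (vec_index (E *\<^sub>v ?u) i)) {..<d} * L2_set (\<lambda>i. cmod (u i)) {..<d}"
        by (rule L2_set_mult_ineq)
      also have "\<dots> = vec_l2_norm (E *\<^sub>v ?u) * vec_l2_norm ?u"
        using E by (simp add: vec_l2_norm_def L2_set_def)
      also have "\<dots> \<le> op_norm E"
        using vec_l2_norm_le_op_norm[OF E, of ?u] u1 by simp
      finally show ?thesis .
    qed
    finally show ?thesis using N by (simp add: N_def[symmetric] mult.commute)
  qed
qed

text \<open>
  The matrices \<open>op_norm E\<close> times the identity plus or minus \<open>E\<close> have quadratic forms with nonnegative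
  real part, and the real part of the trace of their product with the state is
  \<open>op_norm E\<close> plus or minus that of \<open>tr (E \<theta>)\<close>, because the state has unit trace.
\<close>

lemma quantum_state_trace_le_op_norm:
  assumes \<theta>: "\<theta> \<in> quantum_states d" and E: "E \<in> carrier_mat d d"
  shows "\<bar>Re (mtrace (E * \<theta>))\<bar> \<le> op_norm E"
proof -
  have h: "\<theta> \<in> hermitian_mats d" and tr: "mtrace \<theta> = 1" and psd: "positive_semidef d \<theta>"
    using \<theta> by (auto simp: quantum_states_def)
  have c: "\<theta> \<in> carrier_mat d d" by (rule hermitian_carrier[OF h])
  have tr1: "(\<Sum>i<d. \<theta> $$ (i, i)) = 1" using tr c by (simp add: mtrace_def)
  have pq: "0 \<le> Re (quad_form d (\<lambda>i j. \<theta> $$ (i, j)) v)" for v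
    using psd mult_mat_vec_inner[OF c, of v] unfolding positive_semidef_def
    by (metis vec_carrier)
  have main: "0 \<le> op_norm E + s * Re (mtrace (E * \<theta>))" if s: "\<bar>s\<bar> = 1" for s :: real
  proof -
    define H where "H i j = (if i = j then complex_of_real (op_norm E) else 0) + complex_of_real s * E $$ (i, j)" for i j
    have qH: "quad_form d H v = complex_of_real (op_norm E * (\<Sum>i<d. (cmod (v i))\<^sup>2))
        + complex_of_real s * quad_form d (\<lambda>i j. E $$ (i, j)) v" for v
    proof -
      have "quad_form d H v = (\<Sum>i<d. \<Sum>j<d. (if i = j then complex_of_real (op_norm E) * (v i * cnj (v i)) else 0)
          + complex_of_real s * (cnj (v i) * E $$ (i, j) * v j))"
        unfolding quad_form_def by (intro sum.cong refl) (simp add: H_def algebra_simps)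
      also have "\<dots> = (\<Sum>i<d. complex_of_real (op_norm E) * (v i * cnj (v i)))
          + complex_of_real s * quad_form d (\<lambda>i j. E $$ (i, j)) v"
        by (simp add: sum.distrib quad_form_def sum_distrib_left)
      also have "(\<Sum>i<d. complex_of_real (op_norm E) * (v i * cnj (v i)))
          = complex_of_real (op_norm E * (\<Sum>i<d. (cmod (v i))\<^sup>2))"
        by (simp only: complex_norm_square[symmetric] of_real_mult of_real_sum sum_distrib_left)
      finally show ?thesis .
    qed
    have "0 \<le> Re (quad_form d H v)" for v
    proof -
      have "\<bar>s * Re (quad_form d (\<lambda>i j. E $$ (i, j)) v)\<bar> \<le> op_norm E * (\<Sum>i<d. (cmod (v i))\<^sup>2)"
        using quad_form_le_op_norm[OF E, of v] abs_Re_le_cmod[of "quad_form d (\<lambda>i j. E $$ (i, j)) v"] s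
        by (simp add: abs_mult)
      then show ?thesis unfolding qH by simp
    qed
    then have "0 \<le> Re (\<Sum>i<d. \<Sum>j<d. \<theta> $$ (i, j) * H j i)"
      by (intro sum_product_psd_nonneg pq hermitian_index[OF h])
    also have "(\<Sum>i<d. \<Sum>j<d. \<theta> $$ (i, j) * H j i)
        = (\<Sum>i<d. \<Sum>j<d. (if j = i then complex_of_real (op_norm E) * \<theta> $$ (i, i) else 0)
          + complex_of_real s * (E $$ (j, i) * \<theta> $$ (i, j)))"
      by (intro sum.cong refl) (simp add: H_def algebra_simps)
    also have "\<dots> = complex_of_real (op_norm E) * (\<Sum>i<d. \<theta> $$ (i, i))
        + complex_of_real s * (\<Sum>i<d. \<Sum>j<d. E $$ (j, i) * \<theta> $$ (i, j))"
      by (simp add: sum.distrib sum_distrib_left)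
    also have "(\<Sum>i<d. \<Sum>j<d. E $$ (j, i) * \<theta> $$ (i, j)) = mtrace (E * \<theta>)"
      unfolding mtrace_times[OF E c] by (rule sum.swap)
    finally show ?thesis unfolding tr1 by simp
  qed
  from main[of 1] main[of "- 1"] show ?thesis by simp
qed

section \<open>Random orthonormal basis measurements\<close>

lemma mtrace_times_hermitian_real:
  assumes "A \<in> hermitian_mats d" "B \<in> hermitian_mats d"
  shows "mtrace (A * B) = complex_of_real (Re (mtrace (A * B)))"
proof -
  have c: "A \<in> carrier_mat d d" "B \<in> carrier_mat d d"
    using assms by (auto intro: hermitian_carrier)
  have "cnj (mtrace (A * B)) = (\<Sum>i<d. \<Sum>k<d. A $$ (k, i) * B $$ (i, k))"
    unfolding mtrace_times[OF c] cnj_sum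
  proof (intro sum.cong refl)
    fix i k assume "i \<in> {..<d}" "k \<in> {..<d}"
    then show "cnj (A $$ (i, k) * B $$ (k, i)) = A $$ (k, i) * B $$ (i, k)"
      using hermitian_index[OF assms(1), of i k] hermitian_index[OF assms(2), of k i] by simp
  qed
  also have "\<dots> = mtrace (A * B)"
    unfolding mtrace_times[OF c] by (rule sum.swap)
  finally show ?thesis by (simp add: complex_eq_iff)
qed

lemma frob_norm_hermitian:
  assumes "A \<in> hermitian_mats d"
  shows "complex_of_real ((frob_norm A)\<^sup>2) = mtrace (A * A)"
proof -
  have c: "A \<in> carrier_mat d d" using assms by (rule hermitian_carrier)
  have "complex_of_real ((frob_norm A)\<^sup>2) = (\<Sum>i<d. \<Sum>j<d. complex_of_real ((cmod (A $$ (i, j)))\<^sup>2))"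
    using c by (simp add: frob_norm_def sum_nonneg)
  also have "\<dots> = (\<Sum>i<d. \<Sum>j<d. A $$ (i, j) * A $$ (j, i))"
  proof (intro sum.cong refl)
    fix i j assume "i \<in> {..<d}" "j \<in> {..<d}"
    then have "A $$ (j, i) = cnj (A $$ (i, j))" by (intro hermitian_index[OF assms]) auto
    then show "complex_of_real ((cmod (A $$ (i, j)))\<^sup>2) = A $$ (i, j) * A $$ (j, i)"
      by (simp only: complex_norm_square)
  qed
  finally show ?thesis by (simp only: mtrace_times[OF c c])
qed

lemma hermitian_minus:
  assumes "A \<in> hermitian_mats d" "B \<in> hermitian_mats d"
  shows "A - B \<in> hermitian_mats d"
proof -
  have c: "A \<in> carrier_mat d d" "B \<in> carrier_mat d d"
    using assms by (auto intro: hermitian_carrier)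
  have "mat_adjoint (A - B) = A - B"
  proof (rule eq_matI)
    fix i j assume "i < dim_row (A - B)" "j < dim_col (A - B)"
    then have ij: "i < d" "j < d" using c by auto
    have "mat_adjoint (A - B) $$ (i, j) = cnj ((A - B) $$ (j, i))"
      using c ij by (auto simp: mat_adjoint_def mat_of_rows_def)
    also have "\<dots> = (A - B) $$ (i, j)"
      using c ij hermitian_index[OF assms(1) ij(2,1)] hermitian_index[OF assms(2) ij(2,1)] by simp
    finally show "mat_adjoint (A - B) $$ (i, j) = (A - B) $$ (i, j)" .
  qed (use c in \<open>auto simp: mat_adjoint_def mat_of_rows_def\<close>)
  then show ?thesis using minus_carrier_mat[OF c(2)] by (simp add: hermitian_mats_def)
qed

text \<open>The coefficients of \<open>B\<close> are the numbers \<open>tr (E j B)\<close>, which are real for Hermitian matrices.\<close>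

lemma onb_parseval:
  assumes E: "hermitian_onb d E" and B: "B \<in> hermitian_mats d"
  shows "(\<Sum>j<d\<^sup>2. (Re (mtrace (E j * B)))\<^sup>2) = (frob_norm B)\<^sup>2"
proof -
  have cB: "B \<in> carrier_mat d d" using B by (rule hermitian_carrier)
  have hE: "E j \<in> hermitian_mats d" if "j < d\<^sup>2" for j
    using E that by (simp add: hermitian_onb_def)
  have cE: "E j \<in> carrier_mat d d" if "j < d\<^sup>2" for j
    using hE[OF that] by (rule hermitian_carrier)
  have orth: "mtrace (E i * E j) = (if i = j then 1 else 0)" if "i < d\<^sup>2" "j < d\<^sup>2" for i j
    using E that hE[OF that(1)] by (auto simp: hermitian_onb_def hermitian_mats_def)
  obtain a where a: "\<And>m k. m < d \<Longrightarrow> k < d \<Longrightarrow> B $$ (m, k) = (\<Sum>j<d\<^sup>2. a j * E j $$ (m, k))"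
    using E cB unfolding hermitian_onb_def by metis
  have lin: "mtrace (A * B) = (\<Sum>j<d\<^sup>2. a j * mtrace (A * E j))" if A: "A \<in> carrier_mat d d" for A
  proof -
    have "mtrace (A * B) = (\<Sum>i<d. \<Sum>k<d. \<Sum>j<d\<^sup>2. a j * (A $$ (i, k) * E j $$ (k, i)))"
      unfolding mtrace_times[OF A cB]
      by (intro sum.cong refl) (simp add: a sum_distrib_left mult_ac)
    also have "\<dots> = (\<Sum>i<d. \<Sum>j<d\<^sup>2. \<Sum>k<d. a j * (A $$ (i, k) * E j $$ (k, i)))"
      by (intro sum.cong refl sum.swap)
    also have "\<dots> = (\<Sum>j<d\<^sup>2. \<Sum>i<d. \<Sum>k<d. a j * (A $$ (i, k) * E j $$ (k, i)))"
      by (rule sum.swap)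
    also have "\<dots> = (\<Sum>j<d\<^sup>2. a j * mtrace (A * E j))"
      by (intro sum.cong refl) (simp add: mtrace_times[OF A cE] sum_distrib_left)
    finally show ?thesis .
  qed
  have coeff: "a i = complex_of_real (Re (mtrace (E i * B)))" if i: "i < d\<^sup>2" for i
  proof -
    have "mtrace (E i * B) = (\<Sum>j<d\<^sup>2. if j = i then a j else 0)"
      unfolding lin[OF cE[OF i]] using i by (intro sum.cong refl) (simp add: orth)
    also have "\<dots> = a i" using i by simp
    finally show ?thesis using mtrace_times_hermitian_real[OF hE[OF i] B] by simp
  qed
  have comm: "mtrace (B * E j) = mtrace (E j * B)" if "j < d\<^sup>2" for j
    unfolding mtrace_times[OF cB cE[OF that]] mtrace_times[OF cE[OF that] cB]
    by (subst sum.swap) (simp add: mult.commute)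
  have "complex_of_real ((frob_norm B)\<^sup>2) = (\<Sum>j<d\<^sup>2. complex_of_real ((Re (mtrace (E j * B)))\<^sup>2))"
    unfolding frob_norm_hermitian[OF B] lin[OF cB]
  proof (intro sum.cong refl)
    fix j assume "j \<in> {..<d\<^sup>2}"
    then have j: "j < d\<^sup>2" by simp
    show "a j * mtrace (B * E j) = complex_of_real ((Re (mtrace (E j * B)))\<^sup>2)"
      unfolding comm[OF j] coeff[OF j]
      by (subst (2) mtrace_times_hermitian_real[OF hE[OF j] B]) (simp add: power2_eq_square)
  qed
  then have "complex_of_real ((frob_norm B)\<^sup>2) = complex_of_real (\<Sum>j<d\<^sup>2. (Re (mtrace (E j * B)))\<^sup>2)"
    by (simp only: of_real_sum)
  then show ?thesis by (simp only: of_real_eq_iff)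
qed

text \<open>
  The design matrix as a function of the drawn index. Outside the support of the uniform law the family
  \<open>E\<close> is unconstrained and may have the wrong dimensions; sending those indices to zero makes the map
  take values in the \<open>d\<close> by \<open>d\<close> matrices everywhere, as measurability demands.
\<close>

definition basis_matrix :: "nat \<Rightarrow> (nat \<Rightarrow> complex mat) \<Rightarrow> nat \<Rightarrow> complex mat" where
  "basis_matrix d E j = (if j < d\<^sup>2 then of_nat d \<cdot>\<^sub>m E j else 0\<^sub>m d d)"

lemma measurable_basis_matrix:
  assumes "hermitian_onb d E"
  shows "basis_matrix d E \<in> measure_pmf p \<rightarrow>\<^sub>M mat_space d"
  using assms by (auto simp: basis_matrix_def hermitian_onb_def hermitian_mats_def)

text \<open>
  The two maps agree on the support of the uniform law, so that the image measures coincide as set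
  functions.
\<close>

lemma basis_design_eq_distr:
  assumes "d \<ge> 1"
  shows "basis_design d E = distr (measure_pmf (pmf_of_set {..<d\<^sup>2})) (mat_space d) (basis_matrix d E)"
  unfolding basis_design_def distr_def
proof (rule measure_of_eq[OF sets.space_closed])
  fix S :: "complex mat set"
  have "{..<d\<^sup>2} \<noteq> {}" using assms by (simp add: lessThan_empty_iff)
  then show "emeasure (measure_pmf (pmf_of_set {..<d\<^sup>2})) ((\<lambda>j. of_nat d \<cdot>\<^sub>m E j) -` S \<inter> space (measure_pmf (pmf_of_set {..<d\<^sup>2})))
      = emeasure (measure_pmf (pmf_of_set {..<d\<^sup>2})) (basis_matrix d E -` S \<inter> space (measure_pmf (pmf_of_set {..<d\<^sup>2})))"
    by (intro emeasure_eq_AE AE_pmfI) (auto simp: basis_matrix_def set_pmf_of_set)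
qed

text \<open>
  Under the uniform law the scaling by \<open>d\<close> compensates the factor \<open>1 / d\<^sup>2\<close>, so the second moment is exactly
  the squared norm of \<open>B\<close>. The fourth moment is the second one times the bound \<open>(2 K sqrt d)\<^sup>2\<close> on the
  square.
\<close>

lemma basis_design_mgf:
  assumes d: "d \<ge> 1" and E: "hermitian_onb d E" and B: "B \<in> hermitian_mats d"
    and bound: "\<And>j. j < d\<^sup>2 \<Longrightarrow> \<bar>Re (mtrace (E j * B))\<bar> \<le> 2 * K / sqrt (real d)" and l: "l \<ge> 0"
  shows "(\<integral>\<^sup>+ X. ennreal (exp (- l * (Re (mtrace (X * B)))\<^sup>2)) \<partial>basis_design d E)
    \<le> ennreal (exp (- l * (frob_norm B)\<^sup>2 + l\<^sup>2 * (4 * K\<^sup>2 * real d * (frob_norm B)\<^sup>2) / 2))"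
proof -
  let ?U = "pmf_of_set {..<d\<^sup>2}"
  define r where "r j = Re (mtrace (E j * B))" for j
  define w where "w j = real d * r j" for j
  have ne: "{..<d\<^sup>2} \<noteq> {}" using d by (simp add: lessThan_empty_iff)
  have cB: "B \<in> carrier_mat d d" using B by (rule hermitian_carrier)
  have cE: "E j \<in> carrier_mat d d" if "j < d\<^sup>2" for j
    using E that by (auto simp: hermitian_onb_def intro: hermitian_carrier)
  have par: "(\<Sum>j<d\<^sup>2. (r j)\<^sup>2) = (frob_norm B)\<^sup>2"
    unfolding r_def by (rule onb_parseval[OF E B])
  have d2: "real (d\<^sup>2) = real d * real d" by (simp add: power2_eq_square)
  have int: "integrable (measure_pmf ?U) f" for f :: "nat \<Rightarrow> real"
    using ne by (intro integrable_measure_pmf_finite) (simp add: set_pmf_of_set)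
  have E2: "(\<integral>j. (w j)\<^sup>2 \<partial>measure_pmf ?U) = (frob_norm B)\<^sup>2"
  proof -
    have "(\<integral>j. (w j)\<^sup>2 \<partial>measure_pmf ?U) = (\<Sum>j<d\<^sup>2. (w j)\<^sup>2) / real (d\<^sup>2)"
      using ne by (subst integral_pmf_of_set) auto
    also have "(\<Sum>j<d\<^sup>2. (w j)\<^sup>2) = real (d\<^sup>2) * (\<Sum>j<d\<^sup>2. (r j)\<^sup>2)"
      by (simp add: w_def power_mult_distrib sum_distrib_left)
    finally show ?thesis using d by (simp add: par)
  qed
  have wb: "(w j)\<^sup>2 \<le> 4 * K\<^sup>2 * real d" if "j < d\<^sup>2" for j
  proof -
    have "(r j)\<^sup>2 \<le> (2 * K / sqrt (real d))\<^sup>2"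
      using power_mono[OF bound[OF that] abs_ge_zero, of 2] by (simp add: r_def)
    also have "\<dots> = 4 * K\<^sup>2 / real d" by (simp add: power_divide power_mult_distrib)
    finally have "(real d)\<^sup>2 * (r j)\<^sup>2 \<le> (real d)\<^sup>2 * (4 * K\<^sup>2 / real d)" by (intro mult_left_mono) auto
    then show ?thesis using d by (simp add: w_def power_mult_distrib power2_eq_square mult_ac)
  qed
  have E4: "(\<integral>j. (w j) ^ 4 \<partial>measure_pmf ?U) \<le> 4 * K\<^sup>2 * real d * (frob_norm B)\<^sup>2"
  proof -
    have "(\<integral>j. (w j) ^ 4 \<partial>measure_pmf ?U) \<le> (\<integral>j. 4 * K\<^sup>2 * real d * (w j)\<^sup>2 \<partial>measure_pmf ?U)"
    proof (rule integral_mono_AE[OF int int], rule AE_pmfI)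
      fix j assume "j \<in> set_pmf ?U"
      then have "(w j)\<^sup>2 \<le> 4 * K\<^sup>2 * real d" using ne wb by (simp add: set_pmf_of_set)
      then have "(w j)\<^sup>2 * (w j)\<^sup>2 \<le> 4 * K\<^sup>2 * real d * (w j)\<^sup>2" by (intro mult_right_mono) auto
      then show "(w j) ^ 4 \<le> 4 * K\<^sup>2 * real d * (w j)\<^sup>2" by (simp flip: power_add)
    qed
    also have "\<dots> = 4 * K\<^sup>2 * real d * (frob_norm B)\<^sup>2" by (simp add: E2)
    finally show ?thesis .
  qed
  have tr: "Re (mtrace ((of_nat d \<cdot>\<^sub>m E j) * B)) = w j" if "j < d\<^sup>2" for j
  proof -
    have "mtrace ((of_nat d \<cdot>\<^sub>m E j) * B) = of_nat d * mtrace (E j * B)"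
      using cE[OF that] unfolding mtrace_times[OF cE[OF that] cB] mtrace_times[OF smult_carrier_mat[OF cE[OF that]] cB]
      by (simp add: sum_distrib_left mult.assoc)
    then show ?thesis by (simp add: w_def r_def)
  qed
  have "(\<integral>\<^sup>+ X. ennreal (exp (- l * (Re (mtrace (X * B)))\<^sup>2)) \<partial>basis_design d E)
      = (\<integral>\<^sup>+ j. ennreal (exp (- l * (Re (mtrace (basis_matrix d E j * B)))\<^sup>2)) \<partial>measure_pmf ?U)"
    unfolding basis_design_eq_distr[OF d]
  proof (rule nn_integral_distr[OF measurable_basis_matrix[OF E]])
    have "(\<lambda>X. Re (mtrace (X * B))) \<in> borel_measurable (mat_space d)"
      by (intro measurable_compose[OF measurable_mtrace_times[OF refl cB] borel_measurable_Re])
    then have "(\<lambda>X. ennreal (exp (- l * (Re (mtrace (X * B)))\<^sup>2))) \<in> borel_measurable (mat_space d)"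
      by measurable
    then show "(\<lambda>X. ennreal (exp (- l * (Re (mtrace (X * B)))\<^sup>2)))
        \<in> borel_measurable (distr (measure_pmf ?U) (mat_space d) (basis_matrix d E))"
      by (simp only: measurable_distr_eq1)
  qed
  also have "\<dots> = (\<integral>\<^sup>+ j. ennreal (exp (- l * (w j)\<^sup>2)) \<partial>measure_pmf ?U)"
    using ne by (intro nn_integral_cong_AE AE_pmfI) (simp add: set_pmf_of_set basis_matrix_def tr)
  also have "\<dots> \<le> ennreal (exp (- l * (frob_norm B)\<^sup>2 + l\<^sup>2 * (4 * K\<^sup>2 * real d * (frob_norm B)\<^sup>2) / 2))"
    by (rule nn_integral_exp_neg_square_le[OF prob_space_measure_pmf int int E2 E4 l])
  finally show ?thesis .
qed

text \<open>
  The operator norm bounds one measurement of \<open>\<theta> - \<theta>t\<close>, a difference of two states, by twice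
  \<open>K / sqrt d\<close>.
\<close>

lemma coverage_basis_design:
  assumes n: "n \<ge> 1" and d: "d \<ge> 1" and \<sigma>: "\<sigma> > 0" and \<alpha>: "0 < \<alpha>" "\<alpha> < 1" and xi: "is_xi n \<sigma> (\<alpha> / 3) \<xi>"
    and E: "hermitian_onb d E" and K: "K > 0" and op: "\<And>j. j < d\<^sup>2 \<Longrightarrow> op_norm (E j) \<le> K / sqrt (real d)"
    and \<theta>: "\<theta> \<in> quantum_states d" and \<theta>t: "\<theta>t \<in> quantum_states d" and z: "z > 0"
  shows "coverage n d (basis_design d E) \<sigma> \<alpha> \<xi> z \<theta>t \<theta>
    \<ge> 1 - (2 * \<alpha> / 3 + exp (- (1 / ((16 + 8 / 3) * K\<^sup>2)) * z))"
proof -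
  have h: "\<theta> \<in> hermitian_mats d" "\<theta>t \<in> hermitian_mats d" using \<theta> \<theta>t by (auto simp: quantum_states_def)
  note hm = hermitian_minus[OF h]
  define F where "F = (frob_norm (\<theta> - \<theta>t))\<^sup>2"
  have D: "prob_space (basis_design d E)"
    unfolding basis_design_eq_distr[OF d]
    by (rule prob_space.prob_space_distr[OF prob_space_measure_pmf measurable_basis_matrix[OF E]])
  have sD: "sets (basis_design d E) = sets (mat_space d)" by (simp add: basis_design_def)
  have bound: "\<bar>Re (mtrace (E j * (\<theta> - \<theta>t)))\<bar> \<le> 2 * K / sqrt (real d)" if j: "j < d\<^sup>2" for j
  proof -
    have cE: "E j \<in> carrier_mat d d"
      using E j by (auto simp: hermitian_onb_def intro: hermitian_carrier)
    have "mtrace (E j * (\<theta> - \<theta>t)) = mtrace (E j * \<theta>) - mtrace (E j * \<theta>t)"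
      by (rule mtrace_times_minus[OF cE hermitian_carrier[OF h(1)] hermitian_carrier[OF h(2)]])
    then show ?thesis
      using quantum_state_trace_le_op_norm[OF \<theta> cE] quantum_state_trace_le_op_norm[OF \<theta>t cE] op[OF j]
      by simp
  qed
  have E0: "exp (- (1 / ((16 + 8 / 3) * K\<^sup>2)) * z) > 0" by simp
  show ?thesis
  proof (cases "F > 0")
    case True
    define M where "M = 4 * K\<^sup>2 * real d * F"
    have M: "M > 0" using K d True by (simp add: M_def)
    have "coverage n d (basis_design d E) \<sigma> \<alpha> \<xi> z \<theta>t \<theta>
        \<ge> 1 - (2 * \<alpha> / 3 + exp (- ((real n * F + 4 * z * real d) / 3)\<^sup>2 / (2 * real n * M)))"
      using basis_design_mgf[OF d E hm bound] z M
      by (intro coverage_ge_of_energy_mgf[OF n \<sigma> D sD h \<alpha> xi _ F_def]) (auto simp: M_def F_def)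
    moreover have "1 / ((16 + 8 / 3) * K\<^sup>2) * z \<le> ((real n * F + 4 * z * real d) / 3)\<^sup>2 / (2 * real n * M)"
    proof -
      define u where "u = real n * F"
      define v where "v = z * real d"
      have u: "u > 0" and v: "v > 0" using n d True z by (auto simp: u_def v_def)
      \<comment> \<open>Arithmetic and geometric mean of \<open>n F\<close> and \<open>4 z d\<close>; this makes \<open>n\<close>, \<open>F\<close> and \<open>d\<close> cancel.\<close>
      have "0 \<le> (u - 4 * v)\<^sup>2" by simp
      then have "16 * (u * v) \<le> (u + 4 * v)\<^sup>2" by (simp add: power2_eq_square algebra_simps)
      then have "16 * (u * v) / (72 * K\<^sup>2 * (u * real d)) \<le> (u + 4 * v)\<^sup>2 / (72 * K\<^sup>2 * (u * real d))"
        using u K by (intro divide_right_mono) auto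
      also have "\<dots> = ((real n * F + 4 * z * real d) / 3)\<^sup>2 / (2 * real n * M)"
        by (simp add: u_def v_def M_def power_divide mult_ac)
      finally have "16 * (u * v) / (72 * K\<^sup>2 * (u * real d)) \<le> ((real n * F + 4 * z * real d) / 3)\<^sup>2 / (2 * real n * M)" .
      moreover have "16 * (u * v) / (72 * K\<^sup>2 * (u * real d)) = 2 / 9 * (z / K\<^sup>2)"
        using u d K by (simp add: v_def field_simps)
      moreover have "1 / ((16 + 8 / 3) * K\<^sup>2) * z = 3 / 56 * (z / K\<^sup>2)"
        by simp
      moreover have "3 / 56 * (z / K\<^sup>2) \<le> 2 / 9 * (z / K\<^sup>2)"
        using z by (intro mult_right_mono) auto
      ultimately show ?thesis by linarith
    qed
    then have "exp (- ((real n * F + 4 * z * real d) / 3)\<^sup>2 / (2 * real n * M))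
        \<le> exp (- (1 / ((16 + 8 / 3) * K\<^sup>2)) * z)" by simp
    ultimately show ?thesis by linarith
  next
    case False
    then have "F = 0" by (simp add: F_def)
    then have "coverage n d (basis_design d E) \<sigma> \<alpha> \<xi> z \<theta>t \<theta> \<ge> 1 - \<alpha> / 3"
    proof (intro coverage_small_signal[OF n \<sigma> D sD h \<alpha>(1) xi])
      have "0 \<le> z * real d" "0 \<le> sqrt (real n) * zbar n d \<sigma> \<alpha> z \<theta>t \<theta>"
        using z zbar_ge(2)[OF \<alpha> \<sigma> order_refl refl, of n d z \<theta>t \<theta>] by auto
      then show "(real n * (frob_norm (\<theta> - \<theta>t))\<^sup>2 - 2 * (z * real d)) / 2
          \<le> sqrt (real n) * zbar n d \<sigma> \<alpha> z \<theta>t \<theta>"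
        using \<open>F = 0\<close> unfolding F_def by simp
    qed
    then show ?thesis using \<alpha> E0 by linarith
  qed
qed

theorem theorem2:
  shows
   "(\<forall>\<tau>1 \<tau>2 :: real. \<tau>1 > 0 \<longrightarrow> \<tau>2 > 0 \<longrightarrow>
       (\<exists>c::real. c > 0 \<and>
         (\<forall>(n::nat) (d::nat) (\<mu>::real measure) (\<sigma>::real) (\<alpha>::real) (\<xi>::real)
            (\<theta>::complex mat) (\<theta>t::complex mat).
            n \<ge> 1 \<longrightarrow> d \<ge> 1 \<longrightarrow> \<sigma> > 0 \<longrightarrow> 0 < \<alpha> \<longrightarrow> \<alpha> < 1 \<longrightarrow> is_xi n \<sigma> (\<alpha> / 3) \<xi> \<longrightarrow>
            \<theta> \<in> hermitian_mats d \<longrightarrow> real_entries \<theta> \<longrightarrow>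
            \<theta>t \<in> hermitian_mats d \<longrightarrow> real_entries \<theta>t \<longrightarrow>
            centered_unit_variance \<mu> \<longrightarrow> subgaussian_design d \<mu> \<tau>1 \<tau>2 \<longrightarrow>
            coverage n d (iid_entries_design d \<mu>) \<sigma> \<alpha> \<xi> 0 \<theta>t \<theta>
              \<ge> 1 - 2 * \<alpha> / 3 - 2 * exp (- c * real n))))
    \<and>
    (\<forall>(n::nat) (d::nat) (\<sigma>::real) (\<alpha>::real) (\<xi>::real) (\<theta>::complex mat) (\<theta>t::complex mat).
       n \<ge> 1 \<longrightarrow> d \<ge> 1 \<longrightarrow> \<sigma> > 0 \<longrightarrow> 0 < \<alpha> \<longrightarrow> \<alpha> < 1 \<longrightarrow> is_xi n \<sigma> (\<alpha> / 3) \<xi> \<longrightarrow>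
       \<theta> \<in> hermitian_mats d \<longrightarrow> real_entries \<theta> \<longrightarrow>
       \<theta>t \<in> hermitian_mats d \<longrightarrow> real_entries \<theta>t \<longrightarrow>
       coverage n d (iid_entries_design d (gaussian 1)) \<sigma> \<alpha> \<xi> 0 \<theta>t \<theta>
         \<ge> 1 - 2 * \<alpha> / 3 - 2 * exp (- (1 / 24) * real n))
    \<and>
    (\<forall>(n::nat) (d::nat) (E :: nat \<Rightarrow> complex mat) (K::real) (z::real) (\<sigma>::real) (\<alpha>::real) (\<xi>::real)
        (\<theta>::complex mat) (\<theta>t::complex mat).
       n \<ge> 1 \<longrightarrow> d \<ge> 1 \<longrightarrow> \<sigma> > 0 \<longrightarrow> 0 < \<alpha> \<longrightarrow> \<alpha> < 1 \<longrightarrow> is_xi n \<sigma> (\<alpha> / 3) \<xi> \<longrightarrow>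
       hermitian_onb d E \<longrightarrow> K > 0 \<longrightarrow> (\<forall>j<d\<^sup>2. op_norm (E j) \<le> K / sqrt (real d)) \<longrightarrow>
       \<theta> \<in> quantum_states d \<longrightarrow> \<theta>t \<in> quantum_states d \<longrightarrow> z > 0 \<longrightarrow>
       coverage n d (basis_design d E) \<sigma> \<alpha> \<xi> z \<theta>t \<theta>
         \<ge> 1 - 2 * \<alpha> / 3 - 2 * exp (- (1 / ((16 + 8 / 3) * K\<^sup>2)) * z))"
proof (intro conjI allI impI)
  fix \<tau>1 \<tau>2 :: real
  assume \<tau>: "\<tau>1 > 0" "\<tau>2 > 0"
  define c where "c = 1 / (9216 * \<tau>1 * exp (\<tau>2\<^sup>2))"
  have "c > 0" using \<tau> by (simp add: c_def)
  moreover have "1 - 2 * \<alpha> / 3 - 2 * exp (- c * real n) \<le> coverage n d (iid_entries_design d \<mu>) \<sigma> \<alpha> \<xi> 0 \<theta>t \<theta>"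
    if "n \<ge> 1" "\<sigma> > 0" "0 < \<alpha>" "\<alpha> < 1" "is_xi n \<sigma> (\<alpha> / 3) \<xi>"
      "\<theta> \<in> hermitian_mats d" "real_entries \<theta>" "\<theta>t \<in> hermitian_mats d" "real_entries \<theta>t"
      "centered_unit_variance \<mu>" "subgaussian_design d \<mu> \<tau>1 \<tau>2"
    for n d :: nat and \<mu> :: "real measure" and \<sigma> \<alpha> \<xi> :: real and \<theta> \<theta>t :: "complex mat"
    using coverage_subgaussian[OF that(10,11) \<tau>(1) that(1-9)] exp_gt_zero[of "- c * real n"]
    unfolding c_def[symmetric] by linarith
  ultimately show "\<exists>c::real. c > 0 \<and>
         (\<forall>(n::nat) (d::nat) (\<mu>::real measure) (\<sigma>::real) (\<alpha>::real) (\<xi>::real)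
            (\<theta>::complex mat) (\<theta>t::complex mat).
            n \<ge> 1 \<longrightarrow> d \<ge> 1 \<longrightarrow> \<sigma> > 0 \<longrightarrow> 0 < \<alpha> \<longrightarrow> \<alpha> < 1 \<longrightarrow> is_xi n \<sigma> (\<alpha> / 3) \<xi> \<longrightarrow>
            \<theta> \<in> hermitian_mats d \<longrightarrow> real_entries \<theta> \<longrightarrow>
            \<theta>t \<in> hermitian_mats d \<longrightarrow> real_entries \<theta>t \<longrightarrow>
            centered_unit_variance \<mu> \<longrightarrow> subgaussian_design d \<mu> \<tau>1 \<tau>2 \<longrightarrow>
            coverage n d (iid_entries_design d \<mu>) \<sigma> \<alpha> \<xi> 0 \<theta>t \<theta>
              \<ge> 1 - 2 * \<alpha> / 3 - 2 * exp (- c * real n))"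
    by (intro exI[of _ c]) simp
next
  fix n d :: nat and \<sigma> \<alpha> \<xi> :: real and \<theta> \<theta>t :: "complex mat"
  assume "n \<ge> 1" "d \<ge> 1" "\<sigma> > 0" "0 < \<alpha>" "\<alpha> < 1" "is_xi n \<sigma> (\<alpha> / 3) \<xi>"
    "\<theta> \<in> hermitian_mats d" "real_entries \<theta>" "\<theta>t \<in> hermitian_mats d" "real_entries \<theta>t"
  then show "1 - 2 * \<alpha> / 3 - 2 * exp (- (1 / 24) * real n)
      \<le> coverage n d (iid_entries_design d (gaussian 1)) \<sigma> \<alpha> \<xi> 0 \<theta>t \<theta>"
    using coverage_gaussian[of n \<sigma> \<alpha> \<xi> \<theta> d \<theta>t] by linarith
next
  fix n d :: nat and E :: "nat \<Rightarrow> complex mat" and K z \<sigma> \<alpha> \<xi> :: real and \<theta> \<theta>t :: "complex mat"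
  assume "n \<ge> 1" "d \<ge> 1" "\<sigma> > 0" "0 < \<alpha>" "\<alpha> < 1" "is_xi n \<sigma> (\<alpha> / 3) \<xi>"
    "hermitian_onb d E" "K > 0" "\<forall>j<d\<^sup>2. op_norm (E j) \<le> K / sqrt (real d)"
    "\<theta> \<in> quantum_states d" "\<theta>t \<in> quantum_states d" "z > 0"
  then have "coverage n d (basis_design d E) \<sigma> \<alpha> \<xi> z \<theta>t \<theta>
      \<ge> 1 - (2 * \<alpha> / 3 + exp (- (1 / ((16 + 8 / 3) * K\<^sup>2)) * z))"
    by (intro coverage_basis_design) auto
  then show "1 - 2 * \<alpha> / 3 - 2 * exp (- (1 / ((16 + 8 / 3) * K\<^sup>2)) * z)
      \<le> coverage n d (basis_design d E) \<sigma> \<alpha> \<xi> z \<theta>t \<theta>"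
    using exp_gt_zero[of "- (1 / ((16 + 8 / 3) * K\<^sup>2)) * z"] by linarith
qed

end
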